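(* Assume: (i) $F$ is bounded from below, strictly convex and Fréchet differentiable on $Y$, and $\nabla F:Y\to Y$ is Lipschitz continuous on compact subsets of $Y$; (ii) for every $\alpha\ge 0$ the sublevel set $\{u\in\mathcal M : \mathcal G(u)\le\alpha\}$ is weak* compact; (iii) whenever $\{u_k\}_k\subset\operatorname{dom}(\mathcal G)$ and $u_k\rightharpoonup^* u$ for some $u\in\mathcal M$, then $Ku_k\to Ku$ strongly in $Y$. Assume furthermore: (iv) there are a neighborhood $\mathcal N(\bar y)$ of $\bar y$ in $Y$ and $\theta>0$ with $(\nabla F(y_1)-\nabla F(y_2),y_1-y_2)_Y\ge\theta\|y_1-y_2\|_Y^2$ for all $y_1,y_2\in\mathcal N(\bar y)$; (v) there are $N\ge1$ and (distinct) points $\bar u_1,\dots,\bar u_N\in\operatorname{Ext}(B)$ with $\arg\max_{v\in\mathcal B}\langle\bar p,v\rangle=\{v\in\mathcal B:\langle\bar p,v\rangle=1\}=\{\bar u_i\}_{i=1}^N$; (vi) $\{K\bar u_i\}_{i=1}^N\subset Y$ is linearly independent; (vii) the minimizer $\bar u$ of $J$ over $\mathcal M$ (which under (i)-(iii), (v), (vi) is unique and of the form $\bar u=\sum_{i=1}^N\bar\lambda_i\bar u_i$ with $\bar\lambda_i\ge0$) satisfies $\bar\lambda_i>0$ for all $i=1,\dots,N$; (viii) there exist a function $g:\operatorname{Ext}(B)\times\operatorname{Ext}(B)\to[0,\infty)$, constants $\tau,\kappa>0$ and pairwise disjoint $d_{\mathcal B}$-closed neighborhoods $\bar U_i$ of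 $\bar u_i$ in $\mathcal B$, $i=1,\dots,N$, such that for all $i$ and all $u\in U_i:=\bar U_i\cap\operatorname{Ext}(B)$ $$\|K(u-\bar u_i)\|_Y\le\tau\, g(u,\bar u_i),\qquad 1-\langle\bar p,u\rangle\ge\kappa\, g(u,\bar u_i)^2 .$$ Then the FC-GCG algorithm (described in the context) either terminates after a finite number of steps with $\bar u=u_k$ the unique minimizer of $J$, or it generates an infinite sequence $\{u_k\}_k$ for which there exist $c>0$ and $\zeta\in[3/4,1)$ such that $$J(u_k)-\min_{u\in\mathcal M}J(u)\le c\,\zeta^k$$ for all $k\in\mathbb N$ sufficiently large. In the latter case $u_k\rightharpoonup^*\bar u$ in $\mathcal M$.
   Context: Setting: $\mathcal C$ is a separable real Banach space, $\mathcal M=\mathcal C^*$ its topological dual with the dual norm, $\langle p,u\rangle$ denotes the duality pairing of $p\in\mathcal C$, $u\in\mathcal M$. $Y$ is a real Hilbert space, $F:Y\to\mathbb R$ is convex, $K:\mathcal M\to Y$ is linear and weak*-to-weak continuous, hence has a continuous pre-adjoint $K_*:Y\to\mathcal C$ with $\langle K_*y,u\rangle=(Ku,y)_Y$. $\mathcal G:\mathcal M\to[0,\infty]$ is convex, weak* lower semicontinuous and positively one-homogeneous ($\mathcal G(\lambda u)=\lambda\mathcal G(u)$ for $\lambda\ge0$). $J(u)=F(Ku)+\mathcal G(u)$; $\operatorname{dom}(\mathcal G)=\{u:\mathcal G(u)<\infty\}$; $B=\{u\in\mathcal M:\mathcal G(u)\le1\}$; $\operatorname{Ext}(B)$ is the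 set of extremal points of $B$; $\mathcal B=\overline{\operatorname{Ext}(B)}^{*}$ is its weak* closure, and $d_{\mathcal B}$ is a metric on $\mathcal B$ metrizing the weak* topology (it exists since $\mathcal C$ is separable and $\mathcal B$ is weak* compact). Under (i)-(iii) $J$ has a minimizer, and $K\bar u$ is the same for all minimizers $\bar u$; set $\bar y=K\bar u\in Y$ and $\bar p=-K_*\nabla F(\bar y)\in\mathcal C$. FC-GCG algorithm. Initialize with a finite set $\mathcal A_0=\{u^0_i\}_{i=1}^{N_0}\subset\operatorname{Ext}(B)$ and $u_0=\sum_{i=1}^{N_0}\lambda^0_iu^0_i$, $\lambda^0_i>0$. For $k=0,1,2,\dots$, given the finite active set $\mathcal A_k=\{u^k_i\}_{i=1}^{N_k}\subset\operatorname{Ext}(B)$ and $u_k\in\operatorname{cone}(\mathcal A_k)$: (a) compute $p_k=-K_*\nabla F(Ku_k)$ and some $\widehat v_k\in\arg\max_{v\in\operatorname{Ext}(B)}\langle p_k,v\rangle$ (a maximizer exists); (b) if $k\ge1$ and $\langle p_k,\widehat v_k\rangle\le1$, terminate with output $u_k$; (c) set $\mathcal A_k^+=\mathcal A_k\cup\{\widehat v_k\}$, $N_k^+=N_k+1$, $u^k_{N_k^+}=\widehat v_k$ (if $\widehat v_k\in\mathcal A_k$ already, then $\mathcal A_k^+=\mathcal A_k$ and $N_k^+=N_k$); (d) choose any $\lambda^{k+1}\in\arg\min_{\lambda\in[0,\infty)^{N_k^+}}\big[F\big(\sum_{i}\lambda_iKu^k_i\big)+\sum_i\lambda_i\big]$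 and set $u_{k+1}=\sum_{i=1}^{N_k^+}\lambda^{k+1}_iu^k_i$; (e) set $\mathcal A_{k+1}=\mathcal A_k^+\setminus\{u^k_i:\lambda^{k+1}_i=0\}$, $N_{k+1}=\#\mathcal A_{k+1}$. *)

theory Defs
  imports "HOL-Analysis.Analysis"
begin

text \<open>The dual of a Banach space \<open>'c\<close> is the type \<open>'c \<Rightarrow>\<^sub>L real\<close> with the operator norm, and the
  pairing of \<open>p :: 'c\<close> with \<open>u\<close> is \<open>blinfun_apply u p\<close>.  For scalar-valued operators the strong
  operator topology is pointwise convergence on \<open>'c\<close>, that is, the weak* topology.\<close>

abbreviation weak_star :: "('c::real_normed_vector \<Rightarrow>\<^sub>L real) topology" where
  "weak_star \<equiv> strong_operator_topology"

definition weak_topology :: "'a::real_normed_vector topology" where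
  "weak_topology = pullback_topology UNIV (\<lambda>y (f :: 'a \<Rightarrow>\<^sub>L real). blinfun_apply f y) euclidean"

definition strictly_convex :: "('a::real_vector \<Rightarrow> real) \<Rightarrow> bool" where
  "strictly_convex f \<longleftrightarrow>
     (\<forall>x y t. x \<noteq> y \<and> 0 < t \<and> t < 1 \<longrightarrow>
        f ((1 - t) *\<^sub>R x + t *\<^sub>R y) < (1 - t) * f x + t * f y)"

definition convex_ennreal :: "('a::real_vector \<Rightarrow> ennreal) \<Rightarrow> bool" where
  "convex_ennreal G \<longleftrightarrow>
     (\<forall>u v t. 0 \<le> t \<and> t \<le> 1 \<longrightarrow>
        G ((1 - t) *\<^sub>R u + t *\<^sub>R v) \<le> ennreal (1 - t) * G u + ennreal t * G v)"

definition lower_semicontinuous_map :: "'a topology \<Rightarrow> ('a \<Rightarrow> 'b::linorder) \<Rightarrow> bool" where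
  "lower_semicontinuous_map X f \<longleftrightarrow> (\<forall>a. openin X {x \<in> topspace X. a < f x})"

definition pos_homogeneous :: "('a::real_vector \<Rightarrow> ennreal) \<Rightarrow> bool" where
  "pos_homogeneous G \<longleftrightarrow> (\<forall>t\<ge>0. \<forall>u. G (t *\<^sub>R u) = ennreal t * G u)"

definition gradient :: "('y::real_inner \<Rightarrow> real) \<Rightarrow> 'y \<Rightarrow> 'y" where
  "gradient F y = (THE D. GDERIV F y :> D)"

text \<open>The vector chosen here exists when \<open>K\<close> is linear and weak*-to-weak continuous, and is then
  unique because the dual separates points.\<close>

definition preadjoint :: "(('c::real_normed_vector \<Rightarrow>\<^sub>L real) \<Rightarrow> 'y::real_inner) \<Rightarrow> 'y \<Rightarrow> 'c" where
  "preadjoint K y = (SOME p. \<forall>u. blinfun_apply u p = inner (K u) y)"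

definition unit_sublevel :: "('a \<Rightarrow> ennreal) \<Rightarrow> 'a set" where
  "unit_sublevel G = {u. G u \<le> 1}"

definition Ext :: "('a::real_vector \<Rightarrow> ennreal) \<Rightarrow> 'a set" where
  "Ext G = {u. u extreme_point_of unit_sublevel G}"

definition Ext_closure :: "(('c::real_normed_vector \<Rightarrow>\<^sub>L real) \<Rightarrow> ennreal) \<Rightarrow> ('c \<Rightarrow>\<^sub>L real) set" where
  "Ext_closure G = weak_star closure_of Ext G"

definition J :: "('y \<Rightarrow> real) \<Rightarrow> ('a \<Rightarrow> 'y) \<Rightarrow> ('a \<Rightarrow> ennreal) \<Rightarrow> 'a \<Rightarrow> ereal" where
  "J F K G u = ereal (F (K u)) + enn2ereal (G u)"

definition dual_var ::
  "('y::real_inner \<Rightarrow> real) \<Rightarrow> (('c::real_normed_vector \<Rightarrow>\<^sub>L real) \<Rightarrow> 'y) \<Rightarrow> ('c \<Rightarrow>\<^sub>L real) \<Rightarrow> 'c" where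
  "dual_var F K u = - preadjoint K (gradient F (K u))"

text \<open>The extremal points that the insertion step may choose at the iterate \<open>u\<close>.\<close>

definition candidates ::
  "('y::real_inner \<Rightarrow> real) \<Rightarrow> (('c::real_normed_vector \<Rightarrow>\<^sub>L real) \<Rightarrow> 'y) \<Rightarrow>
   (('c \<Rightarrow>\<^sub>L real) \<Rightarrow> ennreal) \<Rightarrow> ('c \<Rightarrow>\<^sub>L real) \<Rightarrow> ('c \<Rightarrow>\<^sub>L real) set" where
  "candidates F K G u =
     {v. is_arg_max (\<lambda>v. blinfun_apply v (dual_var F K u)) (\<lambda>v. v \<in> Ext G) v}"

definition stop_criterion ::
  "('y::real_inner \<Rightarrow> real) \<Rightarrow> (('c::real_normed_vector \<Rightarrow>\<^sub>L real) \<Rightarrow> 'y) \<Rightarrow>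
   nat \<Rightarrow> ('c \<Rightarrow>\<^sub>L real) \<Rightarrow> ('c \<Rightarrow>\<^sub>L real) \<Rightarrow> bool" where
  "stop_criterion F K k u v \<longleftrightarrow> k \<ge> 1 \<and> blinfun_apply v (dual_var F K u) \<le> 1"

text \<open>Active sets are finite sets, and the coefficients of their elements are given by a function
  of which only the values on the active set matter.\<close>

definition subproblem ::
  "('y::real_vector \<Rightarrow> real) \<Rightarrow> ('a \<Rightarrow> 'y) \<Rightarrow> 'a set \<Rightarrow> ('a \<Rightarrow> real) \<Rightarrow> real" where
  "subproblem F K A l = F (\<Sum>a\<in>A. l a *\<^sub>R K a) + (\<Sum>a\<in>A. l a)"

text \<open>One full pass, without termination: insertion of \<open>v\<close>, minimization of the coefficients \<open>l\<close>,
  and removal of the points with coefficient zero.\<close>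

definition fcgcg_step ::
  "('y::real_inner \<Rightarrow> real) \<Rightarrow> (('c::real_normed_vector \<Rightarrow>\<^sub>L real) \<Rightarrow> 'y) \<Rightarrow>
   (('c \<Rightarrow>\<^sub>L real) \<Rightarrow> ennreal) \<Rightarrow> nat \<Rightarrow>
   ('c \<Rightarrow>\<^sub>L real) set \<Rightarrow> ('c \<Rightarrow>\<^sub>L real) \<Rightarrow> ('c \<Rightarrow>\<^sub>L real) set \<Rightarrow> ('c \<Rightarrow>\<^sub>L real) \<Rightarrow> bool" where
  "fcgcg_step F K G k A u A' u' \<longleftrightarrow>
     (\<exists>v l. v \<in> candidates F K G u \<and> \<not> stop_criterion F K k u v \<and>
        is_arg_min (subproblem F K (insert v A)) (\<lambda>l. \<forall>a\<in>insert v A. 0 \<le> l a) l \<and>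
        u' = (\<Sum>a\<in>insert v A. l a *\<^sub>R a) \<and>
        A' = insert v A - {a \<in> insert v A. l a = 0})"

definition fcgcg_terminates ::
  "('y::real_inner \<Rightarrow> real) \<Rightarrow> (('c::real_normed_vector \<Rightarrow>\<^sub>L real) \<Rightarrow> 'y) \<Rightarrow>
   (('c \<Rightarrow>\<^sub>L real) \<Rightarrow> ennreal) \<Rightarrow> nat \<Rightarrow> ('c \<Rightarrow>\<^sub>L real) \<Rightarrow> bool" where
  "fcgcg_terminates F K G k u \<longleftrightarrow> (\<exists>v\<in>candidates F K G u. stop_criterion F K k u v)"

definition fcgcg_init ::
  "('a::real_vector \<Rightarrow> ennreal) \<Rightarrow> 'a set \<Rightarrow> 'a \<Rightarrow> bool" where
  "fcgcg_init G A u \<longleftrightarrow>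
     finite A \<and> A \<subseteq> Ext G \<and> (\<exists>l. (\<forall>a\<in>A. 0 < l a) \<and> u = (\<Sum>a\<in>A. l a *\<^sub>R a))"

text \<open>A maximal run with iterates \<open>u k\<close> and active sets \<open>A k\<close> for \<open>k \<le> T\<close>; the values beyond a
  finite \<open>T\<close> are irrelevant.  A finite run ends where no further pass is possible.  All candidates
  have the same pairing with the dual variable, so this is the case if the stopping criterion
  holds; that it is the only case (a candidate and a minimizer of the subproblem always exist) is not
  presupposed here.\<close>

definition fcgcg_run ::
  "('y::real_inner \<Rightarrow> real) \<Rightarrow> (('c::real_normed_vector \<Rightarrow>\<^sub>L real) \<Rightarrow> 'y) \<Rightarrow>
   (('c \<Rightarrow>\<^sub>L real) \<Rightarrow> ennreal) \<Rightarrow>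
   (nat \<Rightarrow> ('c \<Rightarrow>\<^sub>L real) set) \<Rightarrow> (nat \<Rightarrow> ('c \<Rightarrow>\<^sub>L real)) \<Rightarrow> enat \<Rightarrow> bool" where
  "fcgcg_run F K G A u T \<longleftrightarrow>
     fcgcg_init G (A 0) (u 0) \<and>
     (\<forall>k. enat k < T \<longrightarrow> fcgcg_step F K G k (A k) (u k) (A (Suc k)) (u (Suc k))) \<and>
     (\<forall>n. T = enat n \<longrightarrow> \<not> (\<exists>A' u'. fcgcg_step F K G n (A n) (u n) A' u'))"

end

theory Submission
  imports Defs "HOL-Real_Asymp.Real_Asymp"
begin

text \<open>By Krein--Milman, every minimizer is a nonnegative combination of the points \<open>ub i\<close>, and the
  independence of the \<open>K (ub i)\<close> makes it unique.  A conditional gradient step of small length towards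
  a multiple of the new point shows that the residual tends to zero, hence the iterates converge
  and eventually every active or new point lies in some \<open>Ub i\<close>, with mass near \<open>ub i\<close> bounded
  below.  Let \<open>\<Phi>\<close> be the excess over 1 of the maximal dual pairing.  Then \<open>\<Phi>\<close> dominates the residual,
  the squared error of \<open>K (u k)\<close> by strong monotonicity, and therefore, by the quadratic growth
  condition, the squared distance of \<open>K w\<close> to \<open>K (ub i)\<close> for all these points \<open>w\<close>.  Moving a
  fixed fraction of the mass near \<open>ub i\<close> to the new point in \<open>Ub i\<close> keeps the total mass and
  decreases the objective by a multiple of \<open>\<Phi>\<close>, that is, the residual by a constant factor.\<close>

section \<open>The weak* topology of the dual of a separable space\<close>

text \<open>The regularity hypotheses are local: strong monotonicity holds near
  \<open>K ubar\<close>, growth near the \<open>ub i\<close>, and the gradient is Lipschitz only on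
  compact sets. Hence a crude global step comes first, just to obtain convergence without a rate;
  all trial points stay in the image under \<open>K\<close> of one sublevel set of \<open>G\<close>,
  which is compact and convex, so one Lipschitz constant serves. The residual is formed with the
  total mass of the coefficients instead of \<open>G (u k)\<close>, which may be smaller: this
  larger value is what the passes control, and it bounds the objective from above. The local step
  length can be independent of the iterate because gain and squared displacement are both of order
  \<Phi>; a step towards the far point \<open>Mbd *\<^sub>R K (v k)\<close> has displacement of
  order 1 and yields only a sublinear estimate. To bound the squared distance by \<Phi>, a point
  near \<open>ub i\<close> is compared with \<open>ub i\<close> itself, so that the dual error is
  paired with a small difference. The number 3/4 says nothing about the speed: a smaller factor is
  raised to it.\<close>

lemma limitin_weak_star_iff:
  fixes f :: "'n \<Rightarrow> 'c::real_normed_vector \<Rightarrow>\<^sub>L real"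
  shows "limitin weak_star f l \<F> \<longleftrightarrow> (\<forall>x. ((\<lambda>n. blinfun_apply (f n) x) \<longlongrightarrow> blinfun_apply l x) \<F>)"
proof
  assume "limitin weak_star f l \<F>"
  then show "\<forall>x. ((\<lambda>n. blinfun_apply (f n) x) \<longlongrightarrow> blinfun_apply l x) \<F>"
    using continuous_map_limit[OF strong_operator_topology_continuous_evaluation]
    by (fastforce simp: o_def)
next
  assume R: "\<forall>x. ((\<lambda>n. blinfun_apply (f n) x) \<longlongrightarrow> blinfun_apply l x) \<F>"
  have "limitin (product_topology (\<lambda>i. euclidean) UNIV) (\<lambda>n. blinfun_apply (f n)) (blinfun_apply l) \<F>"
    using R by (auto simp: limitin_componentwise)
  then have lim: "limitin euclidean (\<lambda>n. blinfun_apply (f n)) (blinfun_apply l) \<F>"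
    by (simp add: euclidean_product_topology)
  show "limitin weak_star f l \<F>"
    unfolding limitin_def
  proof (intro conjI allI impI)
    show "l \<in> topspace weak_star"
      by (simp add: strong_operator_topology_topspace)
    fix U :: "('c \<Rightarrow>\<^sub>L real) set"
    assume "openin weak_star U \<and> l \<in> U"
    then obtain V where "open V" "U = blinfun_apply -` V" "l \<in> U"
      unfolding strong_operator_topology_def openin_pullback_topology by auto
    then show "\<forall>\<^sub>F x in \<F>. f x \<in> U"
      using lim unfolding limitin_def by auto
  qed
qed

lemma Hausdorff_weak_star: "Hausdorff_space (weak_star :: ('c::real_normed_vector \<Rightarrow>\<^sub>L real) topology)"
  unfolding Hausdorff_space_def
proof (intro allI impI)
  fix u v :: "'c \<Rightarrow>\<^sub>L real"
  assume "u \<in> topspace weak_star \<and> v \<in> topspace weak_star \<and> u \<noteq> v"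
  then obtain x where x: "blinfun_apply u x \<noteq> blinfun_apply v x"
    by (metis blinfun_eqI)
  then obtain U V where UV: "open U" "open V" "blinfun_apply u x \<in> U" "blinfun_apply v x \<in> V" "U \<inter> V = {}"
    using hausdorff[OF x] by auto
  have *: "openin weak_star {f. blinfun_apply f x \<in> U}" if "open U" for U
    using strong_operator_topology_basis[of "{x}" "\<lambda>_. U" "\<lambda>x. x"] that by simp
  show "\<exists>U V. openin weak_star U \<and> openin weak_star V \<and> u \<in> U \<and> v \<in> V \<and> disjnt U V"
    using *[OF UV(1)] *[OF UV(2)] UV(3-5)
    by (intro exI[of _ "{f. blinfun_apply f x \<in> U}"] exI[of _ "{f. blinfun_apply f x \<in> V}"])
      (auto simp: disjnt_def)
qed

definition dense_sequence :: "(nat \<Rightarrow> 'a::topological_space) \<Rightarrow> bool" where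
  "dense_sequence x \<longleftrightarrow> closure (range x) = UNIV"

lemma separable_imp_dense_sequence:
  assumes "separable_space (euclidean :: 'a::topological_space topology)"
  obtains x :: "nat \<Rightarrow> 'a::topological_space" where "dense_sequence x"
proof -
  obtain C :: "'a set" where C: "countable C" "closure C = UNIV"
    using assms unfolding separable_space_def by auto
  then have "C \<noteq> {}" by auto
  then have "range (from_nat_into C) = C"
    using C by (simp add: range_from_nat_into)
  then show thesis
    using that[of "from_nat_into C"] C unfolding dense_sequence_def by simp
qed

lemma blinfun_eq_on_dense_sequence:
  fixes u v :: "'c::real_normed_vector \<Rightarrow>\<^sub>L real"
  assumes "dense_sequence x" "\<And>n. blinfun_apply u (x n) = blinfun_apply v (x n)"
  shows "u = v"
proof (rule blinfun_eqI)
  fix z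
  have "closed {z. blinfun_apply u z = blinfun_apply v z}"
    by (intro closed_Collect_eq continuous_intros)
  then have "closure (range x) \<subseteq> {z. blinfun_apply u z = blinfun_apply v z}"
    by (intro closure_minimal) (auto simp: assms)
  then show "blinfun_apply u z = blinfun_apply v z"
    using assms unfolding dense_sequence_def by auto
qed

text \<open>The values along a dense sequence embed the dual continuously and injectively into the
  metrizable space of real sequences. On the compact \<open>S\<close> this is a homeomorphism onto
  the image, so a subsequence converging there converges weak*.\<close>

lemma weak_star_seq_compact:
  fixes S :: "('c::real_normed_vector \<Rightarrow>\<^sub>L real) set"
  assumes sep: "separable_space (euclidean :: 'c topology)"
    and S: "compactin weak_star S" and w: "\<And>n. w n \<in> S"
  obtains l r where "l \<in> S" "strict_mono (r :: nat \<Rightarrow> nat)" "limitin weak_star (w \<circ> r) l sequentially"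
proof -
  obtain x :: "nat \<Rightarrow> 'c" where x: "dense_sequence x"
    using separable_imp_dense_sequence[OF sep] .
  define \<Phi> where "\<Phi> u n = blinfun_apply u (x n)" for u :: "'c \<Rightarrow>\<^sub>L real" and n
  have cont: "continuous_map weak_star euclidean \<Phi>"
  proof -
    have "continuous_map weak_star (product_topology (\<lambda>i. euclidean) UNIV) \<Phi>"
      unfolding continuous_map_componentwise_UNIV \<Phi>_def
      using strong_operator_topology_continuous_evaluation by blast
    then show ?thesis by (simp add: euclidean_product_topology)
  qed
  have inj: "u = v" if "\<Phi> u = \<Phi> v" for u v
    using blinfun_eq_on_dense_sequence[OF x] that unfolding \<Phi>_def by metis
  have "compact (\<Phi> ` S)"
    using image_compactin[OF S cont] by simp
  then have "seq_compact (\<Phi> ` S)"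
    by (simp add: compact_eq_seq_compact_metric)
  moreover have "\<forall>n. (\<Phi> \<circ> w) n \<in> \<Phi> ` S" using w by auto
  ultimately obtain l' r where l': "l' \<in> \<Phi> ` S" "strict_mono r" "((\<Phi> \<circ> w) \<circ> r) \<longlonglongrightarrow> l'"
    unfolding seq_compact_def by metis
  then obtain l where l: "l \<in> S" "l' = \<Phi> l" by auto
  have "limitin weak_star (w \<circ> r) l sequentially"
    unfolding limitin_def
  proof (intro conjI allI impI)
    show "l \<in> topspace weak_star"
      by (simp add: strong_operator_topology_topspace)
    fix U :: "('c \<Rightarrow>\<^sub>L real) set"
    assume U: "openin weak_star U \<and> l \<in> U"
    \<comment> \<open>By injectivity the image of the part of \<open>S\<close> outside
      \<open>U\<close> misses \<open>l'\<close>; being compact, it is eventually avoided by the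
      image sequence.\<close>
    have "closedin weak_star (topspace weak_star - U)"
      using U by blast
    then have "compactin weak_star (S \<inter> (topspace weak_star - U))"
      using S compact_Int_closedin by blast
    then have "compact (\<Phi> ` (S \<inter> (topspace weak_star - U)))"
      using image_compactin[OF _ cont] by fastforce
    then have "open (- \<Phi> ` (S \<inter> (topspace weak_star - U)))"
      using compact_imp_closed by blast
    moreover have "l' \<in> - \<Phi> ` (S \<inter> (topspace weak_star - U))"
      using U l inj by auto
    ultimately have "\<forall>\<^sub>F n in sequentially. ((\<Phi> \<circ> w) \<circ> r) n \<in> - \<Phi> ` (S \<inter> (topspace weak_star - U))"
      using l'(3) topological_tendstoD by blast
    then show "\<forall>\<^sub>F n in sequentially. (w \<circ> r) n \<in> U"
      by (rule eventually_mono) (use w in \<open>auto simp: strong_operator_topology_topspace\<close>)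
  qed
  then show thesis using that l l' by blast
qed

lemma compactin_weak_star_imp_closedin:
  fixes S :: "('c::real_normed_vector \<Rightarrow>\<^sub>L real) set"
  assumes "compactin weak_star S"
  shows "closedin weak_star S"
  using Hausdorff_weak_star assms compactin_imp_closedin by blast

lemma weak_star_limit_in_compact:
  fixes S :: "('c::real_normed_vector \<Rightarrow>\<^sub>L real) set"
  assumes "compactin weak_star S" "limitin weak_star f l sequentially"
    "\<forall>\<^sub>F n in sequentially. f n \<in> S"
  shows "l \<in> S"
  using limitin_closedin[OF assms(2) compactin_weak_star_imp_closedin[OF assms(1)] assms(3)]
  by simp

lemma weak_star_attains_sup:
  fixes S :: "('c::real_normed_vector \<Rightarrow>\<^sub>L real) set"
  assumes "compactin weak_star S" "S \<noteq> {}"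
  obtains w where "w \<in> S" "\<And>v. v \<in> S \<Longrightarrow> blinfun_apply v p \<le> blinfun_apply w p"
proof -
  have "compact ((\<lambda>u. blinfun_apply u p) ` S)"
    using image_compactin[OF assms(1) strong_operator_topology_continuous_evaluation[of p]] by simp
  then show thesis
    using compact_attains_sup[of "(\<lambda>u. blinfun_apply u p) ` S"] assms(2) that by auto
qed

lemma weak_star_bounded:
  fixes S :: "('c::real_normed_vector \<Rightarrow>\<^sub>L real) set"
  assumes "compactin weak_star S"
  shows "bounded ((\<lambda>u. blinfun_apply u p) ` S)"
  using image_compactin[OF assms(1) strong_operator_topology_continuous_evaluation[of p]]
  by (simp add: compact_imp_bounded)

section \<open>Exposed faces and extreme points of weak* compact convex sets\<close>

definition max_face :: "'c \<Rightarrow> ('c::real_normed_vector \<Rightarrow>\<^sub>L real) set \<Rightarrow> ('c \<Rightarrow>\<^sub>L real) set" where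
  "max_face p S = {u \<in> S. \<forall>v\<in>S. blinfun_apply v p \<le> blinfun_apply u p}"

lemma max_face_nonempty:
  assumes "compactin weak_star S" "S \<noteq> {}"
  shows "max_face p S \<noteq> {}"
proof -
  obtain w where "w \<in> S" "\<And>v. v \<in> S \<Longrightarrow> blinfun_apply v p \<le> blinfun_apply w p"
    using weak_star_attains_sup[OF assms, of p] by auto
  then have "w \<in> max_face p S" by (auto simp: max_face_def)
  then show ?thesis by auto
qed

lemma compactin_max_face:
  assumes "compactin weak_star S"
  shows "compactin weak_star (max_face p S)"
proof (cases "S = {}")
  case True
  then show ?thesis by (simp add: max_face_def)
next
  case False
  then obtain w where w: "w \<in> S" "\<And>v. v \<in> S \<Longrightarrow> blinfun_apply v p \<le> blinfun_apply w p"
    using weak_star_attains_sup[OF assms] by metis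
  have "max_face p S = S \<inter> {u \<in> topspace weak_star. blinfun_apply u p \<in> {blinfun_apply w p..}}"
    using w by (auto simp: max_face_def strong_operator_topology_topspace intro: order_trans)
  moreover have "closedin weak_star {u \<in> topspace weak_star. blinfun_apply u p \<in> {blinfun_apply w p..}}"
    by (rule closedin_continuous_map_preimage[OF strong_operator_topology_continuous_evaluation]) auto
  ultimately show ?thesis
    using assms compact_Int_closedin by metis
qed

lemma max_face_face_of:
  assumes "convex S"
  shows "max_face p S face_of S"
  unfolding face_of_def
proof (intro conjI ballI impI)
  show "max_face p S \<subseteq> S" by (auto simp: max_face_def)
  show "convex (max_face p S)"
  proof (rule convexI)
    fix x y :: "'a \<Rightarrow>\<^sub>L real" and u v :: real
    assume *: "x \<in> max_face p S" "y \<in> max_face p S" "0 \<le> u" "0 \<le> v" "u + v = 1"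
    then have "blinfun_apply x p = blinfun_apply y p"
      by (auto simp: max_face_def intro: antisym)
    then have "blinfun_apply (u *\<^sub>R x + v *\<^sub>R y) p = blinfun_apply x p"
      using * by (simp add: blinfun.add_left blinfun.scaleR_left flip: distrib_right)
    then show "u *\<^sub>R x + v *\<^sub>R y \<in> max_face p S"
      using * convexD[OF assms] by (auto simp: max_face_def)
  qed
  fix a b x assume *: "a \<in> S" "b \<in> S" "x \<in> max_face p S" "x \<in> open_segment a b"
  then obtain t where t: "0 < t" "t < 1" "x = (1 - t) *\<^sub>R a + t *\<^sub>R b"
    by (auto simp: in_segment)
  have le: "blinfun_apply a p \<le> blinfun_apply x p" "blinfun_apply b p \<le> blinfun_apply x p"
    using * by (auto simp: max_face_def)
  have x: "blinfun_apply x p = (1 - t) * blinfun_apply a p + t * blinfun_apply b p"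
    using t by (simp add: blinfun.add_left blinfun.scaleR_left)
  then have "(1 - t) * (blinfun_apply x p - blinfun_apply a p) + t * (blinfun_apply x p - blinfun_apply b p) = 0"
    by (simp add: algebra_simps)
  moreover have "0 \<le> (1 - t) * (blinfun_apply x p - blinfun_apply a p)" "0 \<le> t * (blinfun_apply x p - blinfun_apply b p)"
    using le t by auto
  ultimately have "(1 - t) * (blinfun_apply x p - blinfun_apply a p) = 0" "t * (blinfun_apply x p - blinfun_apply b p) = 0"
    by linarith+
  then have "blinfun_apply x p = blinfun_apply a p" "blinfun_apply x p = blinfun_apply b p"
    using t by auto
  then show "a \<in> max_face p S" "b \<in> max_face p S"
    using * by (auto simp: max_face_def)
qed

text \<open>Maximizing lexicographically along a dense sequence singles out one point, which is therefore
  extreme; this replaces the appeal to Zorn's lemma in the Krein--Milman theorem.\<close>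

lemma weak_star_extreme_point_exists:
  fixes S :: "('c::real_normed_vector \<Rightarrow>\<^sub>L real) set"
  assumes sep: "separable_space (euclidean :: 'c topology)"
    and S: "compactin weak_star S" "convex S" "S \<noteq> {}"
  obtains e where "e extreme_point_of S"
proof -
  obtain x :: "nat \<Rightarrow> 'c" where x: "dense_sequence x"
    using separable_imp_dense_sequence[OF sep] .
  define M where "M = rec_nat S (\<lambda>n. max_face (x n))"
  have M0: "M 0 = S" and MS: "M (Suc n) = max_face (x n) (M n)" for n
    by (simp_all add: M_def)
  have M: "compactin weak_star (M n) \<and> M n face_of S \<and> M n \<noteq> {}" for n
  proof (induction n)
    case 0
    then show ?case using S by (auto simp: M0 face_of_refl)
  next
    case (Suc n)
    then show ?case
      unfolding MS using compactin_max_face max_face_nonempty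
        face_of_trans[OF max_face_face_of] face_of_imp_convex by blast
  qed
  have dec: "M n \<subseteq> M m" if "m \<le> n" for m n
    by (rule lift_Suc_antimono_le[OF _ that]) (auto simp: MS max_face_def)
  obtain w where w: "\<And>n. w n \<in> M n"
    using choice[of "\<lambda>n w. w \<in> M n"] M by (meson all_not_in_conv)
  have "w n \<in> S" for n
    using w dec[of 0 n] by (auto simp: M0)
  then obtain l r where lr: "l \<in> S" "strict_mono r" "limitin weak_star (w \<circ> r) l sequentially"
    using weak_star_seq_compact[OF sep S(1)] by metis
  \<comment> \<open>The sets decrease and \<open>r k \<ge> k\<close>, so almost all terms of the
    subsequence lie in the closed set \<open>M n\<close>: the intersection is nonempty.\<close>
  have l: "l \<in> M n" for n
  proof (rule weak_star_limit_in_compact[OF _ lr(3)])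
    show "compactin weak_star (M n)" using M by blast
    have "(w \<circ> r) k \<in> M n" if "k \<ge> n" for k
      using w[of "r k"] dec[of n "r k"] seq_suble[OF lr(2), of k] that by auto
    then show "\<forall>\<^sub>F k in sequentially. (w \<circ> r) k \<in> M n"
      using eventually_sequentially by blast
  qed
  have "l' = l" if "\<And>n. l' \<in> M n" for l'
  proof (rule blinfun_eq_on_dense_sequence[OF x])
    fix n
    show "blinfun_apply l' (x n) = blinfun_apply l (x n)"
      using that[of "Suc n"] l[of "Suc n"] unfolding MS max_face_def by (auto intro: antisym)
  qed
  then have "\<Inter> (range M) = {l}"
    using l by auto
  moreover have "\<Inter> (range M) face_of S"
    using M by (intro face_of_Inter) auto
  ultimately show thesis
    using that face_of_singleton by metis
qed

text \<open>Bauer's principle: an extreme point of an exposed face of \<open>S\<close> is extreme in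
  \<open>S\<close>.\<close>

lemma extreme_point_attains_sup:
  fixes S :: "('c::real_normed_vector \<Rightarrow>\<^sub>L real) set"
  assumes sep: "separable_space (euclidean :: 'c topology)"
    and S: "compactin weak_star S" "convex S" "S \<noteq> {}"
  obtains e where "e extreme_point_of S" "e \<in> max_face p S"
proof -
  have "max_face p S face_of S" using max_face_face_of S by blast
  moreover obtain e where "e extreme_point_of max_face p S"
    using weak_star_extreme_point_exists[OF sep compactin_max_face[OF S(1)]]
      max_face_nonempty[OF S(1,3)] face_of_imp_convex calculation by metis
  ultimately show thesis
    using that extreme_point_of_face by metis
qed

section \<open>Separation from norm compact convex sets and a finite Krein--Milman theorem\<close>

text \<open>Norm compactness of \<open>C\<close> lets finitely many evaluations tell
  \<open>w\<close> from all points of \<open>C\<close>. This reduces separation to a projection in a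
  Euclidean space, whose normal is a combination of evaluation points and hence an element of the
  predual.\<close>

lemma weak_star_separation:
  fixes C :: "('c::real_normed_vector \<Rightarrow>\<^sub>L real) set"
  assumes sep: "separable_space (euclidean :: 'c topology)"
    and C: "compact C" "convex C" and w: "w \<notin> C"
  obtains p where "\<And>c. c \<in> C \<Longrightarrow> blinfun_apply c p < blinfun_apply w p"
proof (cases "C = {}")
  case False
  obtain x :: "nat \<Rightarrow> 'c" where x: "dense_sequence x"
    using separable_imp_dense_sequence[OF sep] .
  define Z where "Z c m = (\<forall>n<m. blinfun_apply c (x n) = blinfun_apply w (x n))" for c m
  \<comment> \<open>Otherwise points \<open>c m\<close> of \<open>C\<close> agree with
    \<open>w\<close> at the first \<open>m\<close> evaluation points, and a subsequence converges to
    \<open>w\<close>.\<close>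
  have "\<exists>m. \<forall>c\<in>C. \<not> Z c m"
  proof (rule ccontr)
    assume "\<nexists>m. \<forall>c\<in>C. \<not> Z c m"
    then obtain c where c: "\<And>m. c m \<in> C" "\<And>m. Z (c m) m" by metis
    then obtain l r where lr: "l \<in> C" "strict_mono r" "(c \<circ> r) \<longlonglongrightarrow> l"
      using C(1) unfolding compact_eq_seq_compact_metric seq_compact_def by metis
    have "l = w"
    proof (rule blinfun_eq_on_dense_sequence[OF x])
      fix n
      have "(\<lambda>k. blinfun_apply ((c \<circ> r) k) (x n)) \<longlonglongrightarrow> blinfun_apply l (x n)"
        using lr(3) by (intro tendsto_intros)
      moreover have "\<forall>\<^sub>F k in sequentially. blinfun_apply ((c \<circ> r) k) (x n) = blinfun_apply w (x n)"
      proof (rule eventually_sequentiallyI[of "Suc n"])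
        fix k assume "Suc n \<le> k"
        then have "n < r k" using seq_suble[OF lr(2), of k] by linarith
        then show "blinfun_apply ((c \<circ> r) k) (x n) = blinfun_apply w (x n)"
          using c(2)[of "r k"] by (auto simp: Z_def)
      qed
      ultimately show "blinfun_apply l (x n) = blinfun_apply w (x n)"
        using LIMSEQ_unique[OF _ tendsto_eventually] by blast
    qed
    then show False using lr(1) w by simp
  qed
  then obtain m where m: "\<And>c. c \<in> C \<Longrightarrow> \<not> Z c m" by blast
  define q where "q c = (\<Sum>n<m. (blinfun_apply (w - c) (x n))\<^sup>2)" for c
  have "continuous_on C q"
    unfolding q_def by (intro continuous_intros)
  then obtain d where d: "d \<in> C" "\<And>c. c \<in> C \<Longrightarrow> q d \<le> q c"
    using continuous_attains_inf[OF C(1) False] by blast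
  \<comment> \<open>The residual \<open>w - d\<close> at the projection \<open>d\<close>, read as an
    element of \<open>'c\<close>.\<close>
  define p where "p = (\<Sum>n<m. blinfun_apply (w - d) (x n) *\<^sub>R x n)"
  have pair: "blinfun_apply v p = (\<Sum>n<m. blinfun_apply (w - d) (x n) * blinfun_apply v (x n))" for v
    by (simp add: p_def blinfun.sum_right blinfun.scaleR_right)
  have "q d \<noteq> 0"
  proof
    assume "q d = 0"
    then have "\<forall>n<m. blinfun_apply (w - d) (x n) = 0"
      unfolding q_def by (subst (asm) sum_nonneg_eq_0_iff) auto
    then show False using m[OF d(1)] by (simp add: Z_def blinfun.diff_left)
  qed
  then have qd: "q d > 0"
    by (simp add: q_def sum_nonneg order_less_le)
  have qw: "blinfun_apply (w - d) p = q d"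
    unfolding pair q_def by (simp add: power2_eq_square)
  have "blinfun_apply (c - d) p \<le> 0" if c: "c \<in> C" for c
  proof (rule ccontr)
    assume "\<not> ?thesis"
    then have pos: "blinfun_apply (c - d) p > 0" by simp
    define b where "b = blinfun_apply (c - d) p"
    define a where "a = (\<Sum>n<m. (blinfun_apply (c - d) (x n))\<^sup>2)"
    have a: "a \<ge> 0" by (simp add: a_def sum_nonneg)
    \<comment> \<open>From \<open>d\<close> towards \<open>c\<close>, \<open>q\<close> takes the
      values \<open>q d - 2 * t * b + t\<^sup>2 * a\<close>, below \<open>q d\<close> if
      \<open>t * a \<le> b\<close>; the added 1 covers \<open>a = 0\<close>.\<close>
    define t where "t = min 1 (b / (a + 1))"
    have "t \<le> b / (a + 1)" by (simp add: t_def)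
    then have tb: "t * (a + 1) \<le> b"
      using a by (simp add: pos_le_divide_eq)
    have t: "0 < t" "t \<le> 1"
      using pos a by (auto simp: t_def b_def)
    have "q ((1 - t) *\<^sub>R d + t *\<^sub>R c) = (\<Sum>n<m. (blinfun_apply (w - d) (x n) - t * blinfun_apply (c - d) (x n))\<^sup>2)"
      unfolding q_def by (intro sum.cong) (auto simp: blinfun.bilinear_simps algebra_simps)
    also have "\<dots> = q d - 2 * t * b + t\<^sup>2 * a"
      unfolding q_def a_def b_def pair
      by (simp add: power2_diff sum.distrib sum_subtractf sum_distrib_left power_mult_distrib algebra_simps)
    also have "\<dots> < q d"
    proof -
      have "t\<^sup>2 * a \<le> t * b"
        using t tb a mult_left_mono[of "t * a" b t] by (simp add: power2_eq_square algebra_simps)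
      moreover have "t * b > 0" using t pos by (simp add: b_def)
      ultimately show ?thesis by simp
    qed
    finally have "q ((1 - t) *\<^sub>R d + t *\<^sub>R c) < q d" .
    moreover have "(1 - t) *\<^sub>R d + t *\<^sub>R c \<in> C"
      using C(2) c d(1) t by (simp add: convex_alt)
    ultimately show False using d(2) by fastforce
  qed
  then show thesis
    using that[of p] qw qd by (fastforce simp: blinfun.diff_left)
qed (use that in blast)

text \<open>A point outside the hull is separated by some \<open>p\<close>, whose maximum over
  \<open>S\<close> is attained in \<open>E\<close>. The hull of a finite set is norm compact, so no
  closure is taken.\<close>

lemma Krein_Milman_finite:
  fixes S :: "('c::real_normed_vector \<Rightarrow>\<^sub>L real) set"
  assumes sep: "separable_space (euclidean :: 'c topology)"
    and S: "compactin weak_star S" "convex S"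
    and E: "finite E" "\<And>e. e extreme_point_of S \<Longrightarrow> e \<in> E"
  shows "S \<subseteq> convex hull E"
proof
  fix w assume w: "w \<in> S"
  show "w \<in> convex hull E"
  proof (rule ccontr)
    assume "w \<notin> convex hull E"
    then obtain p where p: "\<And>c. c \<in> convex hull E \<Longrightarrow> blinfun_apply c p < blinfun_apply w p"
      using weak_star_separation[OF sep finite_imp_compact_convex_hull[OF E(1)] convex_convex_hull] by metis
    obtain e where "e extreme_point_of S" "e \<in> max_face p S"
      using extreme_point_attains_sup[OF sep S] w by blast
    then show False
      using p[of e] E(2) w hull_inc[of e E] by (fastforce simp: max_face_def)
  qed
qed

section \<open>Weak* continuous linear functionals are evaluations\<close>

text \<open>Induction on \<open>X\<close>: if some \<open>v\<close> vanishes on \<open>X\<close> but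
  not at \<open>x\<close>, subtracting a multiple of the evaluation at \<open>x\<close> restores the
  hypothesis for \<open>X\<close>; otherwise vanishing on \<open>X\<close> forces vanishing at
  \<open>x\<close>.\<close>

lemma linear_functional_in_span_of_evaluations:
  fixes \<phi> :: "('c::real_normed_vector \<Rightarrow>\<^sub>L real) \<Rightarrow> real"
  assumes "finite X" "linear \<phi>" "\<And>u. (\<forall>x\<in>X. blinfun_apply u x = 0) \<Longrightarrow> \<phi> u = 0"
  shows "\<exists>p. \<forall>u. \<phi> u = blinfun_apply u p"
  using assms
proof (induction X arbitrary: \<phi> rule: finite_induct)
  case empty
  then show ?case by (intro exI[of _ 0]) (simp add: blinfun.zero_right)
next
  case (insert x X)
  interpret linear \<phi> by fact
  show ?case
  proof (cases "\<exists>u :: 'c \<Rightarrow>\<^sub>L real. (\<forall>x\<in>X. blinfun_apply u x = 0) \<and> blinfun_apply u x \<noteq> 0")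
    case True
    then obtain v :: "'c \<Rightarrow>\<^sub>L real" where v: "\<forall>x\<in>X. blinfun_apply v x = 0" "blinfun_apply v x \<noteq> 0" by blast
    define \<psi> where "\<psi> u = \<phi> u - \<phi> v / blinfun_apply v x * blinfun_apply u x" for u
    have "linear \<psi>"
      unfolding \<psi>_def
      by (intro linearI) (auto simp: add scaleR blinfun.add_left blinfun.scaleR_left algebra_simps)
    moreover have "\<psi> u = 0" if u: "\<forall>x\<in>X. blinfun_apply u x = 0" for u
    proof -
      have "\<phi> (u - (blinfun_apply u x / blinfun_apply v x) *\<^sub>R v) = 0"
        using u v by (intro insert.prems) (auto simp: blinfun.diff_left blinfun.scaleR_left)
      then show ?thesis
        by (simp add: diff scaleR \<psi>_def)
    qed
    ultimately obtain p where p: "\<And>u. \<psi> u = blinfun_apply u p"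
      using insert.IH by blast
    have "\<phi> u = blinfun_apply u (p + (\<phi> v / blinfun_apply v x) *\<^sub>R x)" for u
      using p[of u] by (simp add: \<psi>_def blinfun.add_right blinfun.scaleR_right)
    then show ?thesis by blast
  next
    case False
    then show ?thesis
      by (intro insert.IH[OF insert.prems(1)] insert.prems(2)) auto
  qed
qed

text \<open>A basic neighbourhood of 0 restricts finitely many coordinates. If \<open>u\<close>
  vanishes at these, all its multiples stay in the neighbourhood, where the functional is below 1 in
  absolute value, so it is 0 at \<open>u\<close>.\<close>

lemma weak_star_continuous_functional:
  fixes \<phi> :: "('c::real_normed_vector \<Rightarrow>\<^sub>L real) \<Rightarrow> real"
  assumes "linear \<phi>" and cont: "continuous_map weak_star euclidean \<phi>"
  shows "\<exists>p. \<forall>u. \<phi> u = blinfun_apply u p"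
proof -
  interpret linear \<phi> by fact
  have "openin weak_star {u \<in> topspace weak_star. \<phi> u \<in> ball 0 1}"
    by (rule openin_continuous_map_preimage[OF cont]) simp
  then obtain V where V: "open V" "{u. \<phi> u \<in> ball 0 1} = blinfun_apply -` V"
    unfolding strong_operator_topology_def openin_pullback_topology topspace_pullback_topology
    by auto
  have "blinfun_apply 0 \<in> V"
    using V(2) zero by (metis (mono_tags, lifting) centre_in_ball mem_Collect_eq vimage_eq zero_less_one)
  then obtain W where W: "blinfun_apply 0 \<in> Pi\<^sub>E UNIV W" "\<And>i. open (W i)" "finite {i. W i \<noteq> UNIV}" "Pi\<^sub>E UNIV W \<subseteq> V"
    using product_topology_open_contains_basis[of "\<lambda>_. euclidean" UNIV V "blinfun_apply 0"] V(1)
    by (force simp: open_fun_def)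
  show ?thesis
  proof (rule linear_functional_in_span_of_evaluations[OF W(3) assms(1)])
    fix u :: "'c \<Rightarrow>\<^sub>L real" assume u: "\<forall>x\<in>{i. W i \<noteq> UNIV}. blinfun_apply u x = 0"
    have "\<phi> (t *\<^sub>R u) \<in> ball 0 1" for t
    proof -
      have "blinfun_apply (t *\<^sub>R u) i \<in> W i" for i
        using u W(1) by (cases "W i = UNIV") (auto simp: blinfun.scaleR_left PiE_iff)
      then have "t *\<^sub>R u \<in> blinfun_apply -` V"
        using W(4) by (auto simp: PiE_iff)
      then show ?thesis using V(2) by blast
    qed
    from this[of "1 / \<phi> u"] show "\<phi> u = 0"
      by (auto simp: scaleR split: if_splits)
  qed
qed

section \<open>Gradients of convex functions on a Hilbert space\<close>

text \<open>The representer is the minimizer of \<open>q\<close>; the parallelogram identity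
  \<open>mid\<close> makes a minimizing sequence Cauchy.\<close>

theorem Riesz_representation:
  fixes f :: "'y::{real_inner, complete_space} \<Rightarrow> real"
  assumes "bounded_linear f"
  obtains z where "\<And>h. f h = inner h z"
proof -
  interpret bounded_linear f by fact
  obtain B where B: "B > 0" "\<And>x. norm (f x) \<le> norm x * B" using pos_bounded by metis
  define q where "q x = (norm x)\<^sup>2 / 2 - f x" for x
  have q_lb: "q x \<ge> - B\<^sup>2 / 2" for x
  proof -
    have "f x \<le> norm x * B" using B(2)[of x] by simp
    moreover have "0 \<le> (norm x - B)\<^sup>2" by simp
    ultimately show ?thesis by (simp add: q_def power2_diff)
  qed
  have bdd: "bdd_below (range q)"
    using q_lb by (intro bdd_belowI[of _ "- B\<^sup>2 / 2"]) auto
  define m where "m = Inf (range q)"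
  have m_le: "m \<le> q x" for x
    unfolding m_def by (rule cInf_lower[OF _ bdd]) simp
  have "\<exists>x. q x < m + 1 / (real n + 1)" for n
    using cInf_lessD[of "range q" "m + 1 / (real n + 1)"] by (auto simp: m_def)
  then obtain x where x: "\<And>n. q (x n) < m + 1 / (real n + 1)" by metis
  have mid: "(norm (a - b))\<^sup>2 = 4 * q a + 4 * q b - 8 * q ((1/2) *\<^sub>R (a + b))" for a b
    unfolding q_def by (simp add: scaleR add power2_norm_eq_inner inner_simps inner_commute algebra_simps)
  have "Cauchy x"
  proof (rule metric_CauchyI)
    fix e :: real assume e: "0 < e"
    obtain M :: nat where M: "8 / e\<^sup>2 < real M" using reals_Archimedean2 by blast
    have "dist (x a) (x b) < e" if "a \<ge> M" "b \<ge> M" for a b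
    proof -
      have lt: "1 / (real n + 1) < e\<^sup>2 / 8" if "n \<ge> M" for n
      proof -
        have "8 / e\<^sup>2 < real n + 1" using M that by linarith
        then show ?thesis using e by (simp add: field_simps)
      qed
      have "(norm (x a - x b))\<^sup>2 \<le> 4 * q (x a) + 4 * q (x b) - 8 * m"
        using m_le[of "(1/2) *\<^sub>R (x a + x b)"] unfolding mid by simp
      also have "\<dots> < e\<^sup>2" using x[of a] x[of b] lt[OF that(1)] lt[OF that(2)] by linarith
      finally show ?thesis
        using e power2_less_imp_less unfolding dist_norm by fastforce
    qed
    then show "\<exists>M. \<forall>a\<ge>M. \<forall>b\<ge>M. dist (x a) (x b) < e" by blast
  qed
  then obtain z where z: "x \<longlonglongrightarrow> z" using Cauchy_convergent convergent_def by blast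
  have "(\<lambda>n. q (x n)) \<longlonglongrightarrow> q z"
    unfolding q_def by (intro tendsto_intros tendsto z) simp
  moreover have "(\<lambda>n. m + 1 / (real n + 1)) \<longlonglongrightarrow> m + 0"
    by real_asymp
  ultimately have "q z \<le> m + 0"
    by (rule LIMSEQ_le) (use x in \<open>auto intro: less_imp_le\<close>)
  then have qz: "q z \<le> q y" for y using m_le[of y] by simp
  have "f h = inner h z" for h
  proof -
    define d where "d = inner h z - f h"
    define n where "n = (norm h)\<^sup>2"
    have n: "n \<ge> 0" by (simp add: n_def)
    have "q (z + t *\<^sub>R h) = q z + t * d + t\<^sup>2 * n / 2" for t
      unfolding q_def d_def n_def power2_norm_eq_inner
      by (simp add: scaleR add inner_simps inner_commute power2_eq_square algebra_simps)
    then have *: "0 \<le> t * d + t\<^sup>2 * n / 2" for t using qz[of "z + t *\<^sub>R h"] by simp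
    \<comment> \<open>The test value \<open>t = - s * d\<close> gives the increment
      \<open>s * (d\<^sup>2 * (s * n / 2 - 1))\<close>, negative unless \<open>d = 0\<close>, since
      \<open>s * n \<le> 1\<close>.\<close>
    define s where "s = 1 / (n + 1)"
    have s: "s > 0" "s * n \<le> 1" using n by (auto simp: s_def)
    have "0 \<le> s * (d\<^sup>2 * (s * n / 2 - 1))"
      using *[of "- s * d"] by (simp add: power2_eq_square algebra_simps)
    then have "0 \<le> d\<^sup>2 * (s * n / 2 - 1)" using s zero_le_mult_iff by (smt (verit))
    then have "d\<^sup>2 \<le> 0" using s by (simp add: zero_le_mult_iff)
    then show ?thesis by (simp add: d_def)
  qed
  then show thesis using that by blast
qed

lemma GDERIV_gradient:
  fixes F :: "'y::{real_inner, complete_space} \<Rightarrow> real"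
  assumes "F differentiable (at y)"
  shows "GDERIV F y :> gradient F y"
proof -
  obtain F' where F': "(F has_derivative F') (at y)"
    using assms differentiable_def by blast
  obtain z where z: "\<And>h. F' h = inner h z"
    using Riesz_representation[OF has_derivative_bounded_linear[OF F']] by blast
  have "GDERIV F y :> z"
    unfolding gderiv_def using F' z by (metis (no_types, lifting) ext)
  moreover have "D = z" if "GDERIV F y :> D" for D
    using has_derivative_unique[OF that[unfolded gderiv_def] F'] z
    by (metis vector_eq_ldot inner_commute)
  ultimately show ?thesis
    unfolding gradient_def by (rule theI2) 
qed

lemma has_real_derivative_along_line:
  fixes F :: "'y::{real_inner, complete_space} \<Rightarrow> real"
  assumes "F differentiable (at (y + t *\<^sub>R h))"
  shows "((\<lambda>t. F (y + t *\<^sub>R h)) has_real_derivative inner h (gradient F (y + t *\<^sub>R h))) (at t)"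
proof -
  have "((\<lambda>t. y + t *\<^sub>R h) has_derivative (\<lambda>s. s *\<^sub>R h)) (at t)"
    by (auto intro!: derivative_eq_intros)
  from has_derivative_compose[OF this GDERIV_gradient[OF assms, unfolded gderiv_def]]
  show ?thesis by (simp add: has_field_derivative_def mult_commute_abs)
qed

lemma convex_on_above_gradient:
  fixes F :: "'y::{real_inner, complete_space} \<Rightarrow> real"
  assumes "convex_on UNIV F" "F differentiable (at y)"
  shows "F y + inner (z - y) (gradient F y) \<le> F z"
proof -
  define \<phi> where "\<phi> t = F (y + t *\<^sub>R (z - y))" for t
  have der: "(\<phi> has_real_derivative inner (z - y) (gradient F y)) (at 0)"
    using has_real_derivative_along_line[of F y 0 "z - y"] assms(2) by (simp add: \<phi>_def[abs_def])
  have "convex_on UNIV \<phi>"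
  proof (rule convex_onI)
    fix t a b :: real assume t: "0 < t" "t < 1"
    have "y + ((1 - t) *\<^sub>R a + t *\<^sub>R b) *\<^sub>R (z - y)
      = (1 - t) *\<^sub>R (y + a *\<^sub>R (z - y)) + t *\<^sub>R (y + b *\<^sub>R (z - y))"
      by (simp add: algebra_simps)
    then show "\<phi> ((1 - t) *\<^sub>R a + t *\<^sub>R b) \<le> (1 - t) * \<phi> a + t * \<phi> b"
      unfolding \<phi>_def using convex_onD[OF assms(1), of t] t by simp
  qed simp
  from convex_on_imp_above_tangent[OF this, of 0 1 "inner (z - y) (gradient F y)"] der
  have "inner (z - y) (gradient F y) * (1 - 0) \<le> \<phi> 1 - \<phi> 0" by simp
  then show ?thesis by (simp add: \<phi>_def)
qed

text \<open>The tangent inequality at \<open>y + h\<close> costs a factor 2 against the usual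
  constant \<open>L / 2\<close>, but uses the Lipschitz bound at the two end points only.\<close>

lemma convex_on_descent:
  fixes F :: "'y::{real_inner, complete_space} \<Rightarrow> real"
  assumes "convex_on UNIV F" "F differentiable (at (y + h))"
    and "norm (gradient F (y + h) - gradient F y) \<le> L * norm h"
  shows "F (y + h) \<le> F y + inner h (gradient F y) + L * (norm h)\<^sup>2"
proof -
  have "F (y + h) \<le> F y + inner h (gradient F (y + h))"
    using convex_on_above_gradient[OF assms(1,2), of y] by simp
  also have "inner h (gradient F (y + h)) = inner h (gradient F y) + inner h (gradient F (y + h) - gradient F y)"
    by (simp add: inner_diff_right)
  also have "inner h (gradient F (y + h) - gradient F y) \<le> norm h * (L * norm h)"
    using norm_cauchy_schwarz[of h "gradient F (y + h) - gradient F y"]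
      mult_left_mono[OF assms(3) norm_ge_zero[of h]] by linarith
  finally show ?thesis by (simp add: power2_eq_square algebra_simps)
qed

section \<open>Existence and optimality of minimizers\<close>

locale sparse_problem =
  fixes F :: "'y::{real_inner, complete_space} \<Rightarrow> real"
    and K :: "('c::banach \<Rightarrow>\<^sub>L real) \<Rightarrow> 'y"
    and G :: "('c \<Rightarrow>\<^sub>L real) \<Rightarrow> ennreal"
  assumes separable: "separable_space (euclidean :: 'c topology)"
    and F_convex: "convex_on UNIV F"
    and K_linear: "linear K"
    and K_cont: "continuous_map weak_star weak_topology K"
    and G_convex: "convex_ennreal G"
    and G_hom: "pos_homogeneous G"
    and F_bdd: "bdd_below (range F)"
    and F_strict: "strictly_convex F"
    and F_diff: "\<And>y. F differentiable (at y)"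
    and F_lipschitz: "\<And>S. compact S \<Longrightarrow> \<exists>L. L-lipschitz_on S (gradient F)"
    and sublevel_compact: "\<And>\<alpha>::real. 0 \<le> \<alpha> \<Longrightarrow> compactin weak_star {w. G w \<le> ennreal \<alpha>}"
    and K_strong: "\<And>w w\<^sub>0. (\<And>k::nat. G (w k) < \<infinity>) \<Longrightarrow> limitin weak_star w w\<^sub>0 sequentially
                \<Longrightarrow> (\<lambda>k. K (w k)) \<longlonglongrightarrow> K w\<^sub>0"
begin

sublocale K: linear K by (rule K_linear)

abbreviation B where "B \<equiv> unit_sublevel G"

text \<open>\<open>enn2real\<close> sends \<infinity> to 0, so \<open>Gr\<close> and
  \<open>obj\<close> represent \<open>G\<close> and \<open>J\<close> only where
  \<open>G w < \<infinity>\<close>; this is the reason for that guard in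
  \<open>minimizer\<close>.\<close>

definition Gr where "Gr w = enn2real (G w)"

definition obj where "obj w = F (K w) + Gr w"

lemma F_above: "F y + inner (z - y) (gradient F y) \<le> F z"
  using convex_on_above_gradient[OF F_convex F_diff] .

lemma F_continuous: "continuous_on UNIV F"
  using F_diff differentiable_imp_continuous_within continuous_at_imp_continuous_on by blast

lemma F_lim: "(f \<longlongrightarrow> y) \<F> \<Longrightarrow> ((\<lambda>n. F (f n)) \<longlongrightarrow> F y) \<F>"
  using F_continuous continuous_on_tendsto_compose[of UNIV F] by simp

text \<open>The pairing with \<open>y\<close> is continuous for the weak topology, so its
  composition with \<open>K\<close> is weak* continuous and hence an evaluation; this justifies the
  \<open>SOME\<close> in the definition.\<close>

lemma preadjoint: "blinfun_apply v (preadjoint K y) = inner (K v) y"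
proof -
  have "continuous_map weak_topology euclidean ((\<lambda>h. h (blinfun_inner_left y)) \<circ> (\<lambda>y (f :: 'y \<Rightarrow>\<^sub>L real). blinfun_apply f y))"
    unfolding weak_topology_def
    by (rule continuous_map_pullback) (use continuous_on_product_coordinates in fastforce)
  from continuous_map_compose[OF K_cont this]
  have "continuous_map weak_star euclidean (\<lambda>u. inner (K u) y)"
    by (simp add: o_def inner_commute)
  moreover have "linear (\<lambda>u. inner (K u) y)"
    by (intro linearI) (auto simp: K.add K.scaleR inner_simps)
  ultimately have "\<exists>p. \<forall>u. blinfun_apply u p = inner (K u) y"
    using weak_star_continuous_functional by metis
  then have "\<forall>u. blinfun_apply u (preadjoint K y) = inner (K u) y"
    unfolding preadjoint_def by (rule someI_ex)
  then show ?thesis by blast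
qed

lemma dual_var: "blinfun_apply v (dual_var F K u) = - inner (K v) (gradient F (K u))"
  unfolding dual_var_def by (simp add: blinfun.minus_right preadjoint)

section \<open>The gauge \<open>G\<close> and its sublevel sets\<close>

lemma G_scale: "0 \<le> t \<Longrightarrow> G (t *\<^sub>R u) = ennreal t * G u"
  using G_hom unfolding pos_homogeneous_def by blast

lemma G_zero [simp]: "G 0 = 0"
  using G_scale[of 0 0] by simp

lemma G_add: "G (u + v) \<le> G u + G v"
proof -
  have "G ((1 - 1/2) *\<^sub>R (2 *\<^sub>R u) + (1/2) *\<^sub>R (2 *\<^sub>R v))
    \<le> ennreal (1 - 1/2) * G (2 *\<^sub>R u) + ennreal (1/2) * G (2 *\<^sub>R v)"
    using G_convex[unfolded convex_ennreal_def, rule_format, of "1/2" "2 *\<^sub>R u" "2 *\<^sub>R v"] by simp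
  also have "ennreal (1/2) * G (2 *\<^sub>R w) = G w" for w
    using G_scale[of "1/2" "2 *\<^sub>R w"] by simp
  moreover have "1 - 1/2 = (1/2 :: real)" by simp
  ultimately show ?thesis by simp
qed

lemma G_sum:
  assumes "finite I" "\<And>i. i \<in> I \<Longrightarrow> 0 \<le> l i" "\<And>i. i \<in> I \<Longrightarrow> G (a i) \<le> 1"
  shows "G (\<Sum>i\<in>I. l i *\<^sub>R a i) \<le> ennreal (\<Sum>i\<in>I. l i)"
  using assms
proof (induction I rule: finite_induct)
  case (insert i I)
  have "G (\<Sum>i\<in>insert i I. l i *\<^sub>R a i) \<le> G (l i *\<^sub>R a i) + G (\<Sum>i\<in>I. l i *\<^sub>R a i)"
    using insert.hyps G_add by simp
  also have "G (l i *\<^sub>R a i) \<le> ennreal (l i) * 1"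
    using insert.prems G_scale[of "l i"] mult_left_mono[of "G (a i)" 1 "ennreal (l i)"] by simp
  also have "G (\<Sum>i\<in>I. l i *\<^sub>R a i) \<le> ennreal (\<Sum>i\<in>I. l i)"
    using insert by simp
  finally show ?case
    using insert by (simp add: ennreal_plus[symmetric] sum_nonneg add_mono del: ennreal_plus)
qed simp

lemma G_eq_Gr: "G w < \<infinity> \<Longrightarrow> G w = ennreal (Gr w)"
  unfolding Gr_def by (simp add: less_top)

lemma Gr_nonneg [simp]: "0 \<le> Gr w" by (simp add: Gr_def)

lemma Gr_le: "0 \<le> t \<Longrightarrow> G w \<le> ennreal t \<Longrightarrow> Gr w \<le> t"
  unfolding Gr_def using enn2real_mono[of "G w" "ennreal t"] by simp

lemma G_finite: "G w \<le> ennreal t \<Longrightarrow> G w < \<infinity>"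
  using le_less_trans[of "G w" "ennreal t" top] by simp

lemma Gr_scale: "0 \<le> t \<Longrightarrow> Gr (t *\<^sub>R w) = t * Gr w"
  unfolding Gr_def by (simp add: G_scale enn2real_mult)

lemma G_convex_combination:
  assumes "0 \<le> t" "t \<le> 1" "G w < \<infinity>" "G v < \<infinity>"
  shows "G ((1 - t) *\<^sub>R w + t *\<^sub>R v) \<le> ennreal ((1 - t) * Gr w + t * Gr v)"
proof -
  have "G ((1 - t) *\<^sub>R w + t *\<^sub>R v) \<le> ennreal (1 - t) * ennreal (Gr w) + ennreal t * ennreal (Gr v)"
    using assms G_add[of "(1 - t) *\<^sub>R w" "t *\<^sub>R v"] G_eq_Gr[of w] G_eq_Gr[of v] by (simp add: G_scale)
  also have "\<dots> = ennreal ((1 - t) * Gr w + t * Gr v)"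
    using assms ennreal_plus[of "(1 - t) * Gr w" "t * Gr v"] by (simp add: ennreal_mult[symmetric])
  finally show ?thesis .
qed

lemma convex_sublevel: "convex {w. G w \<le> ennreal c}"
proof (rule convexI)
  fix x y :: "'c \<Rightarrow>\<^sub>L real" and u v :: real
  assume *: "x \<in> {w. G w \<le> ennreal c}" "y \<in> {w. G w \<le> ennreal c}" "0 \<le> u" "0 \<le> v" "u + v = 1"
  have "G (u *\<^sub>R x + v *\<^sub>R y) \<le> ennreal u * G x + ennreal v * G y"
    using G_add[of "u *\<^sub>R x" "v *\<^sub>R y"] * G_scale by simp
  also have "\<dots> \<le> ennreal u * ennreal c + ennreal v * ennreal c"
    using * by (intro add_mono mult_left_mono) auto
  also have "\<dots> = ennreal c"
    using * by (simp add: distrib_right[symmetric] ennreal_plus[symmetric] del: ennreal_plus)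
  finally show "u *\<^sub>R x + v *\<^sub>R y \<in> {w. G w \<le> ennreal c}" by simp
qed

lemma B_eq: "B = {w. G w \<le> ennreal 1}"
  by (simp add: unit_sublevel_def)

lemma B_compact: "compactin weak_star B" and B_convex: "convex B" and B_nonempty: "B \<noteq> {}"
  unfolding B_eq using sublevel_compact[of 1] convex_sublevel[of 1] by (auto intro: exI[of _ 0])

lemma Ext_subset_B: "Ext G \<subseteq> B"
  unfolding Ext_def by (auto simp: extreme_point_of_def)

lemma Ext_G_le: "v \<in> Ext G \<Longrightarrow> G v \<le> 1"
  using Ext_subset_B by (auto simp: unit_sublevel_def)

text \<open>\<open>K_strong\<close> makes \<open>K\<close> sequentially weak*-to-norm continuous on
  sublevel sets. Norm compact images are what makes a Lipschitz condition on compact sets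
  usable.\<close>

lemma K_image_compact:
  assumes "0 \<le> \<alpha>"
  shows "compact (K ` {w. G w \<le> ennreal \<alpha>})"
  unfolding compact_eq_seq_compact_metric seq_compact_def
proof (intro allI impI)
  fix f :: "nat \<Rightarrow> 'y" assume "\<forall>n. f n \<in> K ` {w. G w \<le> ennreal \<alpha>}"
  then have "\<forall>n. \<exists>w. G w \<le> ennreal \<alpha> \<and> f n = K w" by auto
  then obtain w where w: "\<And>n. G (w n) \<le> ennreal \<alpha>" "\<And>n. f n = K (w n)" by metis
  obtain l r where lr: "l \<in> {w. G w \<le> ennreal \<alpha>}" "strict_mono r" "limitin weak_star (w \<circ> r) l sequentially"
    using weak_star_seq_compact[OF separable sublevel_compact[OF assms], of w] w by auto
  have "(\<lambda>k. K ((w \<circ> r) k)) \<longlonglongrightarrow> K l"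
    by (rule K_strong[OF _ lr(3)]) (use w G_finite in auto)
  then have "(f \<circ> r) \<longlonglongrightarrow> K l" by (simp add: o_def w)
  then show "\<exists>l\<in>K ` {w. G w \<le> ennreal \<alpha>}. \<exists>r. strict_mono r \<and> (f \<circ> r) \<longlonglongrightarrow> l"
    using lr by blast
qed

text \<open>The sublevel set at 0 is a cone on which evaluations are bounded by compactness, so they
  vanish there.\<close>

lemma G_le_zero:
  assumes "G w \<le> 0"
  shows "w = 0"
proof (rule blinfun_eqI)
  fix x
  have "bounded ((\<lambda>u. blinfun_apply u x) ` {w. G w \<le> ennreal 0})"
    by (rule weak_star_bounded[OF sublevel_compact]) simp
  then obtain M where M: "\<And>u. G u \<le> 0 \<Longrightarrow> \<bar>blinfun_apply u x\<bar> \<le> M"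
    unfolding bounded_iff by auto
  have *: "t * \<bar>blinfun_apply w x\<bar> \<le> M" if "t \<ge> 0" for t
    using M[of "t *\<^sub>R w"] assms that by (simp add: G_scale blinfun.scaleR_left abs_mult)
  show "blinfun_apply w x = blinfun_apply 0 x"
  proof (rule ccontr)
    assume "blinfun_apply w x \<noteq> blinfun_apply 0 x"
    then have "0 < \<bar>blinfun_apply w x\<bar>" by simp
    then obtain n :: nat where "M < real n * \<bar>blinfun_apply w x\<bar>"
      using ex_less_of_nat_mult by blast
    then show False using *[of "real n"] by simp
  qed
qed

lemma Gr_zero: "G w < \<infinity> \<Longrightarrow> Gr w = 0 \<Longrightarrow> w = 0"
  by (rule G_le_zero) (simp add: G_eq_Gr)

lemma normalized_in_B:
  assumes "G w < \<infinity>" "w \<noteq> 0"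
  shows "0 < Gr w" "(1 / Gr w) *\<^sub>R w \<in> B"
proof -
  show pos: "0 < Gr w" using Gr_zero[OF assms(1)] assms(2) Gr_nonneg[of w] by linarith
  have "G ((1 / Gr w) *\<^sub>R w) = ennreal (1 / Gr w) * ennreal (Gr w)"
    using G_scale[of "1 / Gr w" w] G_eq_Gr[OF assms(1)] by simp
  also have "\<dots> = 1"
    using pos by (simp add: ennreal_mult[symmetric])
  finally show "(1 / Gr w) *\<^sub>R w \<in> B"
    by (simp add: unit_sublevel_def)
qed

lemma le_on_B_if_le_on_Ext:
  assumes "\<And>v. v \<in> Ext G \<Longrightarrow> blinfun_apply v p \<le> c" "v \<in> B"
  shows "blinfun_apply v p \<le> c"
proof -
  obtain e where "e extreme_point_of B" "e \<in> max_face p B"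
    using extreme_point_attains_sup[OF separable B_compact B_convex B_nonempty] by blast
  then have "e \<in> Ext G" "blinfun_apply v p \<le> blinfun_apply e p"
    using assms(2) by (auto simp: Ext_def max_face_def)
  then show ?thesis using assms(1) by force
qed

lemma le_Gr_if_le_on_Ext:
  assumes "\<And>v. v \<in> Ext G \<Longrightarrow> blinfun_apply v p \<le> c" "0 \<le> c" "G w < \<infinity>"
  shows "blinfun_apply w p \<le> c * Gr w"
proof (cases "w = 0")
  case False
  note n = normalized_in_B[OF assms(3) False]
  from le_on_B_if_le_on_Ext[OF assms(1) n(2)] n(1) show ?thesis
    by (simp add: blinfun.scaleR_left field_simps)
qed (simp add: Gr_def)

lemma candidates_nonempty: "candidates F K G u \<noteq> {}"
proof -
  obtain e where "e extreme_point_of B" "e \<in> max_face (dual_var F K u) B"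
    using extreme_point_attains_sup[OF separable B_compact B_convex B_nonempty] by blast
  then have "e \<in> candidates F K G u"
    using Ext_subset_B by (force simp: candidates_def is_arg_max_def max_face_def Ext_def not_less)
  then show ?thesis by blast
qed

lemma candidatesD:
  assumes "v \<in> candidates F K G u"
  shows "v \<in> Ext G" "\<And>w. w \<in> Ext G \<Longrightarrow> blinfun_apply w (dual_var F K u) \<le> blinfun_apply v (dual_var F K u)"
  using assms by (auto simp: candidates_def is_arg_max_def not_less)

section \<open>Minimizers: existence, first-order conditions, common image under
  \<open>K\<close>\<close>

lemma J_finite: "G w < \<infinity> \<Longrightarrow> J F K G w = ereal (obj w)"
  unfolding J_def obj_def using G_eq_Gr[of w] by simp

lemma J_infinite: "\<not> G w < \<infinity> \<Longrightarrow> J F K G w = \<infinity>"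
  unfolding J_def by (simp add: less_top[symmetric])

definition minimizer where
  "minimizer w \<longleftrightarrow> G w < \<infinity> \<and> (\<forall>v. G v < \<infinity> \<longrightarrow> obj w \<le> obj v)"

lemma is_arg_min_J_iff: "is_arg_min (J F K G) (\<lambda>_. True) w \<longleftrightarrow> minimizer w"
proof
  assume *: "is_arg_min (J F K G) (\<lambda>_. True) w"
  have fin: "G w < \<infinity>"
  proof (rule ccontr)
    assume "\<not> G w < \<infinity>"
    then have "J F K G 0 < J F K G w"
      using J_finite[of 0] J_infinite[of w] by simp
    then show False using * unfolding is_arg_min_def by blast
  qed
  moreover have "obj w \<le> obj v" if "G v < \<infinity>" for v
    using * J_finite[OF fin] J_finite[OF that] unfolding is_arg_min_def
    by (metis ereal_less_eq(3) not_le)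
  ultimately show "minimizer w" unfolding minimizer_def by blast
next
  assume w: "minimizer w"
  have "J F K G w \<le> J F K G v" for v
    using w J_finite[of w] J_finite[of v] J_infinite[of v] unfolding minimizer_def
    by (cases "G v < \<infinity>") auto
  then show "is_arg_min (J F K G) (\<lambda>_. True) w"
    unfolding is_arg_min_def by (simp add: not_less)
qed

text \<open>As \<open>F\<close> is bounded below, bounded objective values bound \<open>G\<close>
  and give a weak* convergent subsequence along which \<open>F\<close> of the images converges. Then
  \<open>Gr\<close> converges to some \<open>\<beta>\<close>, and closedness of the sublevel sets at
  \<open>\<beta> + e\<close> transfers the bound to \<open>l\<close>.\<close>

lemma minimizing_sequence_limit:
  assumes fin: "\<And>n. G (w n) < \<infinity>" and lim: "(\<lambda>n. obj (w n)) \<longlonglongrightarrow> c"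
  obtains l r where "strict_mono (r :: nat \<Rightarrow> nat)" "limitin weak_star (w \<circ> r) l sequentially"
    "G l < \<infinity>" "obj l \<le> c"
proof -
  obtain m where m: "\<And>y. m \<le> F y" using F_bdd unfolding bdd_below_def by auto
  obtain M where M: "\<And>n. \<bar>obj (w n)\<bar> \<le> M"
    using convergent_imp_bounded[OF lim] unfolding bounded_iff by auto
  define \<alpha> where "\<alpha> = max 0 (M - m)"
  have G_le: "G (w n) \<le> ennreal \<alpha>" for n
  proof -
    have "Gr (w n) \<le> \<alpha>" using M[of n] m[of "K (w n)"] by (simp add: obj_def \<alpha>_def)
    then show ?thesis using G_eq_Gr[OF fin[of n]] by (simp add: ennreal_leI)
  qed
  have "0 \<le> \<alpha>" by (simp add: \<alpha>_def)
  then obtain l r where lr: "l \<in> {w. G w \<le> ennreal \<alpha>}" "strict_mono r" "limitin weak_star (w \<circ> r) l sequentially"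
    using weak_star_seq_compact[OF separable sublevel_compact, of \<alpha> w] G_le by auto
  have "(\<lambda>k. K ((w \<circ> r) k)) \<longlonglongrightarrow> K l"
    by (rule K_strong[OF _ lr(3)]) (use fin in auto)
  then have Fl: "(\<lambda>k. F (K ((w \<circ> r) k))) \<longlonglongrightarrow> F (K l)" by (rule F_lim)
  have "(\<lambda>k. obj ((w \<circ> r) k)) \<longlonglongrightarrow> c"
    using LIMSEQ_subseq_LIMSEQ[OF lim lr(2)] by (simp add: o_def)
  from tendsto_diff[OF this Fl] have Grl: "(\<lambda>k. Gr ((w \<circ> r) k)) \<longlonglongrightarrow> c - F (K l)"
    by (simp add: obj_def)
  define \<beta> where "\<beta> = c - F (K l)"
  have \<beta>: "0 \<le> \<beta>"
    unfolding \<beta>_def by (rule LIMSEQ_le_const[OF Grl]) auto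
  have "Gr l \<le> \<beta> + e" if "e > 0" for e
  proof -
    have ev: "\<forall>\<^sub>F k in sequentially. Gr ((w \<circ> r) k) < \<beta> + e"
      using order_tendstoD(2)[OF Grl, of "\<beta> + e"] that by (simp add: \<beta>_def)
    have "l \<in> {w. G w \<le> ennreal (\<beta> + e)}"
    proof (rule weak_star_limit_in_compact[OF sublevel_compact lr(3)])
      show "0 \<le> \<beta> + e" using \<beta> that by simp
      show "\<forall>\<^sub>F k in sequentially. (w \<circ> r) k \<in> {w. G w \<le> ennreal (\<beta> + e)}"
        by (rule eventually_mono[OF ev]) (simp add: G_eq_Gr[OF fin] ennreal_leI)
    qed
    then show ?thesis using Gr_le[of "\<beta> + e" l] \<beta> that by simp
  qed
  then have "Gr l \<le> \<beta>" by (rule field_le_epsilon)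
  then have "obj l \<le> c" by (simp add: obj_def \<beta>_def)
  then show thesis using that lr G_finite by blast
qed

lemma minimizer_exists: "\<exists>w. minimizer w"
proof -
  obtain m where m: "\<And>y. m \<le> F y" using F_bdd unfolding bdd_below_def by auto
  define V where "V = obj ` {w. G w < \<infinity>}"
  have "0 \<in> {w. G w < \<infinity>}" by simp
  then have "V \<noteq> {}" unfolding V_def by blast
  have "bdd_below V"
    unfolding V_def obj_def bdd_below_def
    by (intro exI[of _ m]) (auto intro: add_increasing2 m)
  have "\<exists>w. G w < \<infinity> \<and> obj w < Inf V + 1 / (real n + 1)" for n
    using cInf_lessD[OF \<open>V \<noteq> {}\<close>, of "Inf V + 1 / (real n + 1)"] by (auto simp: V_def)
  then obtain w where w: "\<And>n. G (w n) < \<infinity>" "\<And>n. obj (w n) < Inf V + 1 / (real n + 1)" by metis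
  have V_le: "Inf V \<le> obj v" if "G v < \<infinity>" for v
    using that by (intro cInf_lower \<open>bdd_below V\<close>) (simp add: V_def)
  have lim: "(\<lambda>n. obj (w n)) \<longlonglongrightarrow> Inf V"
  proof (rule tendsto_sandwich[of "\<lambda>_. Inf V" _ _ "\<lambda>n. Inf V + 1 / (real n + 1)"])
    show "(\<lambda>n. Inf V + 1 / (real n + 1)) \<longlonglongrightarrow> Inf V" by real_asymp
  qed (use w V_le in \<open>auto intro: always_eventually less_imp_le\<close>)
  obtain l where "G l < \<infinity>" "obj l \<le> Inf V"
    using minimizing_sequence_limit[OF w(1) lim] by blast
  then show ?thesis
    unfolding minimizer_def using V_le order_trans by blast
qed

text \<open>Linearizing \<open>F\<close> at \<open>w\<close> shows that \<open>w\<close> minimizes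
  \<open>Gr v\<close> minus the pairing with the dual variable on the domain of \<open>G\<close>; by
  homogeneity this minimum is 0.\<close>

lemma minimizer_optimality:
  assumes w: "minimizer w" and v: "G v < \<infinity>"
  shows "blinfun_apply v (dual_var F K w) \<le> Gr v"
    and "blinfun_apply w (dual_var F K w) = Gr w"
proof -
  have fin: "G w < \<infinity>" using w by (simp add: minimizer_def)
  have main: "Gr w - blinfun_apply w (dual_var F K w) \<le> Gr v - blinfun_apply v (dual_var F K w)" if v: "G v < \<infinity>" for v
  proof -
    define d where "d = inner (K v - K w) (gradient F (K w)) + (Gr v - Gr w)"
    \<comment> \<open>\<open>Gr\<close> along the segment is replaced by its chord, an upper bound,
      so that \<open>\<phi>\<close> is differentiable at 0.\<close>
    define \<phi> where "\<phi> t = F (K w + t *\<^sub>R (K v - K w)) + t * (Gr v - Gr w)" for t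
    have der: "(\<phi> has_real_derivative d) (at 0)"
      using has_real_derivative_along_line[of F "K w" 0 "K v - K w"] F_diff
      unfolding \<phi>_def[abs_def] d_def by (auto intro!: derivative_eq_intros)
    have "0 \<le> d"
    proof (rule ccontr)
      assume "\<not> 0 \<le> d"
      then obtain e where e: "e > 0" "\<And>h. 0 < h \<Longrightarrow> h < e \<Longrightarrow> \<phi> (0 + h) < \<phi> 0"
        using DERIV_neg_dec_right[OF der] by auto
      define t where "t = min (e / 2) 1"
      have t: "0 < t" "t < e" "t \<le> 1" using e by (auto simp: t_def)
      define z where "z = (1 - t) *\<^sub>R w + t *\<^sub>R v"
      have Gz: "G z \<le> ennreal ((1 - t) * Gr w + t * Gr v)"
        unfolding z_def using t fin v by (intro G_convex_combination) auto
      then have Grz: "Gr z \<le> (1 - t) * Gr w + t * Gr v" using t by (intro Gr_le) auto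
      have "obj w \<le> obj z" using w G_finite[OF Gz] by (simp add: minimizer_def)
      also have "\<dots> \<le> \<phi> t + Gr w"
      proof -
        have "K z = K w + t *\<^sub>R (K v - K w)"
          unfolding z_def K.add K.scaleR by (simp add: algebra_simps)
        moreover have "(1 - t) * Gr w + t * Gr v = Gr w + t * (Gr v - Gr w)"
          by (simp add: algebra_simps)
        ultimately show ?thesis using Grz by (simp add: obj_def \<phi>_def)
      qed
      finally show False using e(2)[of t] t by (simp add: \<phi>_def obj_def)
    qed
    then show ?thesis by (simp add: d_def dual_var inner_simps)
  qed
  \<comment> \<open>The test points 0 and \<open>2 *\<^sub>R w\<close> give the two
    inequalities.\<close>
  have "G (2 *\<^sub>R w) < \<infinity>"
    using fin by (simp add: G_scale ennreal_mult_less_top)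
  then show *: "blinfun_apply w (dual_var F K w) = Gr w"
    using main[of 0] main[of "2 *\<^sub>R w"] by (simp add: Gr_scale blinfun.scaleR_left) (simp add: Gr_def)
  show "blinfun_apply v (dual_var F K w) \<le> Gr v"
    using main[OF v] * by simp
qed

text \<open>Converse of the optimality conditions, by convexity of \<open>F\<close>. When the
  algorithm stops, the hypotheses are the stopping criterion and the equality of pairing and total
  mass.\<close>

lemma minimizer_if_dual_bound:
  assumes "\<And>v. v \<in> Ext G \<Longrightarrow> blinfun_apply v (dual_var F K u) \<le> 1"
    and "0 \<le> blinfun_apply u (dual_var F K u)" "G u \<le> ennreal (blinfun_apply u (dual_var F K u))"
  shows "minimizer u"
  unfolding minimizer_def
proof (intro conjI allI impI)
  show "G u < \<infinity>" using G_finite assms(3) by blast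
  fix w assume w: "G w < \<infinity>"
  have "blinfun_apply w (dual_var F K u) \<le> Gr w"
    using le_Gr_if_le_on_Ext[OF assms(1) _ w] by simp
  moreover have "Gr u \<le> blinfun_apply u (dual_var F K u)"
    using Gr_le assms by blast
  ultimately show "obj u \<le> obj w"
    using F_above[of "K u" "K w"] by (simp add: obj_def dual_var inner_simps)
qed

lemma minimizer_K_unique:
  assumes "minimizer w" "minimizer v"
  shows "K w = K v"
proof (rule ccontr)
  assume ne: "K w \<noteq> K v"
  have fin: "G w < \<infinity>" "G v < \<infinity>" and eq: "obj w = obj v"
    using assms by (auto simp: minimizer_def intro: antisym)
  define z where "z = (1 - 1/2) *\<^sub>R w + (1/2) *\<^sub>R v"
  have Gz: "G z \<le> ennreal ((1 - 1/2) * Gr w + 1/2 * Gr v)"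
    unfolding z_def using fin by (intro G_convex_combination) auto
  then have Grz: "Gr z \<le> (1 - 1/2) * Gr w + 1/2 * Gr v" by (intro Gr_le) auto
  have "F (K z) < (1 - 1/2) * F (K w) + 1/2 * F (K v)"
    using F_strict[unfolded strictly_convex_def, rule_format, of "K w" "K v" "1/2"] ne
    unfolding z_def K.add K.scaleR by simp
  then have "obj z < obj w" using Grz eq by (simp add: obj_def)
  moreover have "obj w \<le> obj z" using assms G_finite[OF Gz] by (simp add: minimizer_def)
  ultimately show False by simp
qed

section \<open>Passes of the algorithm\<close>

lemma subproblem_minimizer_exists:
  assumes "finite C"
  shows "\<exists>l. is_arg_min (subproblem F K C) (\<lambda>l. \<forall>a\<in>C. 0 \<le> l a) l"
proof -
  obtain m where m: "\<And>y. m \<le> F y" using F_bdd unfolding bdd_below_def by auto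
  \<comment> \<open>Zero coefficients have the value \<open>m + M\<close>, so a coefficient above
    \<open>M\<close> cannot do better and a box suffices. Coefficients off \<open>C\<close> are
    pinned to 0 to make it compact among all functions.\<close>
  define M where "M = F 0 - m"
  have M: "0 \<le> M" using m[of 0] by (simp add: M_def)
  define D :: "(('c \<Rightarrow>\<^sub>L real) \<Rightarrow> real) set" where "D = Pi\<^sub>E UNIV (\<lambda>a. if a \<in> C then {0..M} else {0})"
  have "compactin (product_topology (\<lambda>_. euclidean) UNIV) D"
    unfolding D_def by (subst compactin_PiE) auto
  then have "compact D"
    by (simp add: euclidean_product_topology)
  moreover have "(\<lambda>_. 0) \<in> D" using M by (auto simp: D_def)
  moreover have "continuous_on D (subproblem F K C)"
    unfolding subproblem_def
    by (intro continuous_intros continuous_on_compose2[OF F_continuous]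
        continuous_on_product_coordinates[THEN continuous_on_subset]) auto
  ultimately obtain l where l: "l \<in> D" "\<And>l'. l' \<in> D \<Longrightarrow> subproblem F K C l \<le> subproblem F K C l'"
    using continuous_attains_inf[of D "subproblem F K C"] by blast
  have "subproblem F K C l \<le> subproblem F K C l'" if l': "\<forall>a\<in>C. 0 \<le> l' a" for l'
  proof (cases "\<forall>a\<in>C. l' a \<le> M")
    case True
    define l'' where "l'' a = (if a \<in> C then l' a else 0)" for a
    have "l'' \<in> D" using True l' by (auto simp: D_def l''_def)
    moreover have "subproblem F K C l'' = subproblem F K C l'"
      by (simp add: subproblem_def l''_def)
    ultimately show ?thesis using l(2) by force
  next
    case False
    then obtain a where a: "a \<in> C" "M < l' a" by force
    have "subproblem F K C l \<le> subproblem F K C (\<lambda>_. 0)"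
      by (rule l(2)) fact
    also have "\<dots> = m + M" by (simp add: subproblem_def M_def)
    also have "\<dots> \<le> F (\<Sum>a\<in>C. l' a *\<^sub>R K a) + l' a" using m a by (intro add_mono) auto
    also have "\<dots> \<le> subproblem F K C l'"
      unfolding subproblem_def using member_le_sum[of a C l'] a l' assms by simp
    finally show ?thesis .
  qed
  moreover have "0 \<le> l a" if "a \<in> C" for a
    using PiE_mem[OF l(1)[unfolded D_def] UNIV_I[of a]] that by simp
  ultimately show ?thesis
    unfolding is_arg_min_def by (intro exI[of _ l]) (auto simp: not_less)
qed

text \<open>A positive coefficient can be perturbed in both directions, so the one-dimensional
  derivative vanishes.\<close>

lemma subproblem_optimality:
  assumes l: "is_arg_min (subproblem F K C) (\<lambda>l. \<forall>a\<in>C. 0 \<le> l a) l"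
    and C: "finite C" "a \<in> C" "0 < l a"
  shows "inner (K a) (gradient F (\<Sum>a\<in>C. l a *\<^sub>R K a)) = - 1"
proof -
  define y where "y = (\<Sum>a\<in>C. l a *\<^sub>R K a)"
  define \<phi> where "\<phi> t = F (y + t *\<^sub>R K a) + t" for t
  have "(\<phi> has_real_derivative inner (K a) (gradient F y) + 1) (at 0)"
    using has_real_derivative_along_line[of F y 0 "K a"] F_diff
    unfolding \<phi>_def[abs_def] by (auto intro!: derivative_eq_intros)
  moreover have "\<phi> 0 \<le> \<phi> t" if t: "\<bar>0 - t\<bar> < l a" for t
  proof -
    define l' where "l' = l(a := l a + t)"
    have "\<forall>a\<in>C. 0 \<le> l' a"
      using l t by (auto simp: l'_def is_arg_min_def)
    then have le: "subproblem F K C l \<le> subproblem F K C l'"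
      using l unfolding is_arg_min_def by (meson not_less)
    have "(\<Sum>x\<in>C. l' x *\<^sub>R K x) = y + t *\<^sub>R K a"
      unfolding y_def l'_def using C by (simp add: sum.remove[of C a] scaleR_left_distrib)
    moreover have "(\<Sum>x\<in>C. l' x) = (\<Sum>x\<in>C. l x) + t"
      unfolding l'_def using C by (simp add: sum.remove[of C a])
    ultimately show ?thesis
      using le by (simp add: subproblem_def \<phi>_def y_def)
  qed
  ultimately have "inner (K a) (gradient F y) + 1 = 0"
    using C(3) by (intro DERIV_local_min[of \<phi> _ 0 "l a"]) auto
  then show ?thesis by (simp add: y_def)
qed

text \<open>The value of the subproblem at its solution \<open>u\<close>: the sum of the coefficients equals the
  pairing with the dual variable.\<close>

definition val where "val u = F (K u) + blinfun_apply u (dual_var F K u)"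

lemma K_sum: "K (\<Sum>a\<in>C. l a *\<^sub>R a) = (\<Sum>a\<in>C. l a *\<^sub>R K a)"
  by (simp add: K.sum K.scaleR)

text \<open>The state left by a coefficient minimization; the last conjunct is complementary
  slackness. The initial data need not satisfy it.\<close>

definition active where
  "active A u l \<longleftrightarrow> finite A \<and> A \<subseteq> Ext G \<and> (\<forall>a\<in>A. 0 < l a) \<and> u = (\<Sum>a\<in>A. l a *\<^sub>R a) \<and>
     (\<forall>a\<in>A. blinfun_apply a (dual_var F K u) = 1)"

lemma activeD:
  assumes "active A u l"
  shows "finite A" "A \<subseteq> Ext G" "\<And>a. a \<in> A \<Longrightarrow> 0 < l a" "u = (\<Sum>a\<in>A. l a *\<^sub>R a)"
    "\<And>a. a \<in> A \<Longrightarrow> blinfun_apply a (dual_var F K u) = 1"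
    "blinfun_apply u (dual_var F K u) = (\<Sum>a\<in>A. l a)"
    "G u \<le> ennreal (\<Sum>a\<in>A. l a)" "0 \<le> (\<Sum>a\<in>A. l a)"
proof -
  show *: "finite A" "A \<subseteq> Ext G" "\<And>a. a \<in> A \<Longrightarrow> 0 < l a" "u = (\<Sum>a\<in>A. l a *\<^sub>R a)"
    "\<And>a. a \<in> A \<Longrightarrow> blinfun_apply a (dual_var F K u) = 1"
    using assms by (auto simp: active_def)
  have "blinfun_apply u (dual_var F K u) = (\<Sum>a\<in>A. l a * blinfun_apply a (dual_var F K u))"
    by (subst *(4)) (simp add: blinfun.sum_left blinfun.scaleR_left)
  then show "blinfun_apply u (dual_var F K u) = (\<Sum>a\<in>A. l a)"
    using *(5) by simp
  show "G u \<le> ennreal (\<Sum>a\<in>A. l a)"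
    unfolding *(4) using * Ext_G_le by (intro G_sum) (auto intro: less_imp_le)
  show "0 \<le> (\<Sum>a\<in>A. l a)" using * by (intro sum_nonneg) (auto intro: less_imp_le)
qed

lemma active_obj_le_val: "active A u l \<Longrightarrow> obj u \<le> val u"
  using activeD(6,7,8)[of A u l] Gr_le unfolding obj_def val_def by simp

lemma fcgcg_stepD:
  assumes "fcgcg_step F K G k A u A' u'" "finite A" "A \<subseteq> Ext G"
  obtains v l where "v \<in> candidates F K G u" "\<not> stop_criterion F K k u v" "active A' u' l"
    "\<And>l'. (\<And>a. a \<in> insert v A \<Longrightarrow> 0 \<le> l' a) \<Longrightarrow>
      val u' \<le> F (\<Sum>a\<in>insert v A. l' a *\<^sub>R K a) + (\<Sum>a\<in>insert v A. l' a)"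
proof -
  obtain v l where v: "v \<in> candidates F K G u" "\<not> stop_criterion F K k u v"
    and l: "is_arg_min (subproblem F K (insert v A)) (\<lambda>l. \<forall>a\<in>insert v A. 0 \<le> l a) l"
    and u': "u' = (\<Sum>a\<in>insert v A. l a *\<^sub>R a)"
    and A': "A' = insert v A - {a \<in> insert v A. l a = 0}"
    using assms(1) unfolding fcgcg_step_def by blast
  define C where "C = insert v A"
  have C: "finite C" "C \<subseteq> Ext G" "A' \<subseteq> C" using assms v candidatesD(1) by (auto simp: C_def A')
  have l0: "\<forall>a\<in>C. 0 \<le> l a" using l by (simp add: is_arg_min_def C_def)
  have Ku': "K u' = (\<Sum>a\<in>C. l a *\<^sub>R K a)" by (simp add: u' K_sum C_def)
  have active: "active A' u' l"
    unfolding active_def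
  proof (intro conjI ballI)
    show "finite A'" "A' \<subseteq> Ext G" using C finite_subset by blast+
    show "u' = (\<Sum>a\<in>A'. l a *\<^sub>R a)"
      unfolding u' C_def[symmetric] by (rule sum.mono_neutral_right[OF C(1,3)]) (auto simp: A' C_def)
    fix a assume a: "a \<in> A'"
    then show "0 < l a" using l0 by (force simp: A' C_def)
    then show "blinfun_apply a (dual_var F K u') = 1"
      using subproblem_optimality[OF l, of a] C a by (simp add: dual_var Ku' C_def subset_iff)
  qed
  have "(\<Sum>a\<in>A'. l a) = (\<Sum>a\<in>C. l a)"
    by (rule sum.mono_neutral_left[OF C(1,3)]) (auto simp: A' C_def)
  then have "val u' = subproblem F K C l"
    unfolding val_def activeD(6)[OF active] subproblem_def Ku' by simp
  moreover have "subproblem F K C l \<le> subproblem F K C l'" if "\<And>a. a \<in> C \<Longrightarrow> 0 \<le> l' a" for l'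
    using l that unfolding is_arg_min_def C_def by (meson not_less)
  ultimately have "val u' \<le> F (\<Sum>a\<in>insert v A. l' a *\<^sub>R K a) + (\<Sum>a\<in>insert v A. l' a)"
    if "\<And>a. a \<in> insert v A \<Longrightarrow> 0 \<le> l' a" for l'
    using that unfolding subproblem_def C_def by simp
  then show thesis using that v active by blast
qed

text \<open>\<open>v\<close> may already belong to \<open>A\<close>; the two weights then add up,
  without a case distinction.\<close>

lemma sum_insert_weights:
  fixes f :: "'a \<Rightarrow> 'b::real_vector"
  assumes "finite A"
  shows "(\<Sum>a\<in>insert v A. ((if a \<in> A then l a else 0) + (if a = v then b else 0)) *\<^sub>R f a)
    = (\<Sum>a\<in>A. l a *\<^sub>R f a) + b *\<^sub>R f v"
proof -
  have "(\<Sum>a\<in>insert v A. (if a \<in> A then l a else 0) *\<^sub>R f a) = (\<Sum>a\<in>A. (if a \<in> A then l a else 0) *\<^sub>R f a)"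
    using assms by (intro sum.mono_neutral_right) auto
  moreover have "(\<Sum>a\<in>insert v A. (if a = v then b else 0) *\<^sub>R f a) = (\<Sum>a\<in>{v}. (if a = v then b else 0) *\<^sub>R f a)"
    using assms by (intro sum.mono_neutral_right) auto
  ultimately show ?thesis
    by (simp add: scaleR_left_distrib sum.distrib)
qed

lemma fcgcg_step_value:
  assumes "fcgcg_step F K G k A u A' u'" "finite A" "A \<subseteq> Ext G"
  obtains v l where "v \<in> candidates F K G u" "\<not> stop_criterion F K k u v" "active A' u' l"
    "\<And>l' b. (\<And>a. a \<in> A \<Longrightarrow> 0 \<le> l' a) \<Longrightarrow> 0 \<le> b \<Longrightarrow>
      val u' \<le> F ((\<Sum>a\<in>A. l' a *\<^sub>R K a) + b *\<^sub>R K v) + ((\<Sum>a\<in>A. l' a) + b)"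
proof -
  obtain v l where v: "v \<in> candidates F K G u" "\<not> stop_criterion F K k u v" "active A' u' l"
    "\<And>l'. (\<And>a. a \<in> insert v A \<Longrightarrow> 0 \<le> l' a) \<Longrightarrow>
      val u' \<le> F (\<Sum>a\<in>insert v A. l' a *\<^sub>R K a) + (\<Sum>a\<in>insert v A. l' a)"
    using fcgcg_stepD[OF assms] by blast
  have "val u' \<le> F ((\<Sum>a\<in>A. l' a *\<^sub>R K a) + b *\<^sub>R K v) + ((\<Sum>a\<in>A. l' a) + b)"
    if "\<And>a. a \<in> A \<Longrightarrow> 0 \<le> l' a" "0 \<le> b" for l' b
    using v(4)[of "\<lambda>a. (if a \<in> A then l' a else 0) + (if a = v then b else 0)"] that
      sum_insert_weights[OF assms(2), where v = v and l = l' and b = b and f = K]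
      sum_insert_weights[OF assms(2), where v = v and l = l' and b = b and f = "\<lambda>_. 1 :: real"]
    by simp
  then show thesis using that v(1-3) by blast
qed

section \<open>Finite and infinite runs\<close>

lemma fcgcg_step_exists:
  assumes "finite A" "v \<in> candidates F K G u" "\<not> stop_criterion F K k u v"
  shows "\<exists>A' u'. fcgcg_step F K G k A u A' u'"
  unfolding fcgcg_step_def using assms subproblem_minimizer_exists[of "insert v A"] by blast

lemma fcgcg_run_invariant:
  assumes "fcgcg_run F K G A u T" "enat k \<le> T"
  shows "finite (A k) \<and> A k \<subseteq> Ext G \<and> (k \<ge> 1 \<longrightarrow> (\<exists>l. active (A k) (u k) l))"
  using assms(2)
proof (induction k)
  case 0
  then show ?case using assms(1) by (auto simp: fcgcg_run_def fcgcg_init_def)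
next
  case (Suc k)
  then have k: "enat k < T" by (simp add: Suc_ile_eq)
  then have "fcgcg_step F K G k (A k) (u k) (A (Suc k)) (u (Suc k))"
    using assms(1) by (simp add: fcgcg_run_def)
  then show ?case
    using fcgcg_stepD[of k "A k" "u k"] Suc.IH k activeD(1,2) less_imp_le by metis
qed

lemma fcgcg_run_finite:
  assumes run: "fcgcg_run F K G A u (enat n)"
  shows "fcgcg_terminates F K G n (u n) \<and> minimizer (u n)"
proof -
  obtain v where v: "v \<in> candidates F K G (u n)" using candidates_nonempty by blast
  have inv: "finite (A n)" "n \<ge> 1 \<Longrightarrow> \<exists>l. active (A n) (u n) l"
    using fcgcg_run_invariant[OF run, of n] by auto
  \<comment> \<open>A pass exists whenever the criterion fails, so a maximal finite run ends with
    the criterion satisfied. It includes \<open>n \<ge> 1\<close>, which makes \<open>active\<close>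
    available.\<close>
  have stop: "stop_criterion F K n (u n) v"
    using fcgcg_step_exists[OF inv(1) v] run unfolding fcgcg_run_def by blast
  then obtain l where l: "active (A n) (u n) l" using inv(2) by (auto simp: stop_criterion_def)
  have "minimizer (u n)"
  proof (rule minimizer_if_dual_bound)
    fix w assume "w \<in> Ext G"
    then show "blinfun_apply w (dual_var F K (u n)) \<le> 1"
      using candidatesD(2)[OF v] stop by (force simp: stop_criterion_def)
  qed (use activeD(6-8)[OF l] in auto)
  then show ?thesis using v stop by (auto simp: fcgcg_terminates_def)
qed

text \<open>What the rate analysis uses of a step: the new value beats every choice of weights on
  the old active set and \<open>v\<close>. For \<open>k \<ge> 1\<close>, not stopping means a
  pairing above 1.\<close>

definition pass where
  "pass A u u' v \<longleftrightarrow> v \<in> candidates F K G u \<and> 1 < blinfun_apply v (dual_var F K u) \<and>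
     (\<forall>l' b. (\<forall>a\<in>A. 0 \<le> l' a) \<longrightarrow> 0 \<le> b \<longrightarrow>
       val u' \<le> F ((\<Sum>a\<in>A. l' a *\<^sub>R K a) + b *\<^sub>R K v) + ((\<Sum>a\<in>A. l' a) + b))"

lemma fcgcg_step_pass:
  assumes "fcgcg_step F K G k A u A' u'" "finite A" "A \<subseteq> Ext G" "1 \<le> k"
  shows "\<exists>v. pass A u u' v"
proof -
  obtain v l where "v \<in> candidates F K G u" "\<not> stop_criterion F K k u v" "active A' u' l"
    "\<And>l' b. (\<And>a. a \<in> A \<Longrightarrow> 0 \<le> l' a) \<Longrightarrow> 0 \<le> b \<Longrightarrow>
      val u' \<le> F ((\<Sum>a\<in>A. l' a *\<^sub>R K a) + b *\<^sub>R K v) + ((\<Sum>a\<in>A. l' a) + b)"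
    using fcgcg_step_value[OF assms(1-3)] by blast
  then show ?thesis
    unfolding pass_def stop_criterion_def using assms(4) by (intro exI[of _ v]) auto
qed

lemma fcgcg_run_infinite:
  assumes run: "fcgcg_run F K G A u \<infinity>"
  shows "\<exists>l v. \<forall>k. active (A (Suc k)) (u (Suc k)) (l k) \<and> pass (A (Suc k)) (u (Suc k)) (u (Suc (Suc k))) (v k)"
proof -
  have "\<exists>l. active (A (Suc k)) (u (Suc k)) l" for k
    using fcgcg_run_invariant[OF run, of "Suc k"] by simp
  moreover have "\<exists>v. pass (A (Suc k)) (u (Suc k)) (u (Suc (Suc k))) v" for k
    using fcgcg_run_invariant[OF run, of "Suc k"] run
    by (intro fcgcg_step_pass[of "Suc k" _ _ "A (Suc (Suc k))"]) (simp_all add: fcgcg_run_def)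
  ultimately show ?thesis by metis
qed

end

section \<open>The sparse minimizer\<close>

lemma independent_coefficients_eq:
  fixes x :: "'i \<Rightarrow> 'y::real_vector"
  assumes "finite I" "inj_on x I" "independent (x ` I)"
    and eq: "(\<Sum>i\<in>I. b i *\<^sub>R x i) = (\<Sum>i\<in>I. c i *\<^sub>R x i)" and i: "i \<in> I"
  shows "b i = c i"
proof -
  define d where "d z = b (the_inv_into I x z) - c (the_inv_into I x z)" for z
  have "(\<Sum>z\<in>x ` I. d z *\<^sub>R z) = (\<Sum>i\<in>I. (b i - c i) *\<^sub>R x i)"
    using assms by (subst sum.reindex) (auto simp: d_def the_inv_into_f_f intro!: sum.cong)
  also have "\<dots> = 0" using eq by (simp add: scaleR_left_diff_distrib sum_subtractf)
  finally have "d (x i) = 0"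
    using independentD[OF assms(3), of "x ` I" d "x i"] assms(1) i by simp
  then show ?thesis using assms(2) i by (simp add: d_def the_inv_into_f_f)
qed

text \<open>A subsequence staying away from \<open>b j\<close> would have a further one whose
  bounded coefficients converge, and independence identifies their limit. Countability of the index
  type makes the functions on it a metric space.\<close>

lemma independent_coefficients_tendsto:
  fixes x :: "'i::countable \<Rightarrow> 'y::real_normed_vector"
  assumes I: "finite I" "inj_on x I" "independent (x ` I)"
    and bd: "\<And>k i. i \<in> I \<Longrightarrow> \<bar>c k i\<bar> \<le> M"
    and lim: "(\<lambda>k. \<Sum>i\<in>I. c k i *\<^sub>R x i) \<longlonglongrightarrow> (\<Sum>i\<in>I. b i *\<^sub>R x i)"
    and j: "j \<in> I"
  shows "(\<lambda>k. c k j) \<longlonglongrightarrow> b j"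
proof (rule ccontr)
  assume "\<not> ?thesis"
  then obtain e where e: "e > 0" "\<And>n. \<exists>k\<ge>n. e \<le> dist (c k j) (b j)"
    unfolding lim_sequentially by (meson not_le)
  then have "infinite {k. e \<le> dist (c k j) (b j)}"
    unfolding infinite_nat_iff_unbounded_le by auto
  then obtain r :: "nat \<Rightarrow> nat" where r: "strict_mono r" "\<And>k. e \<le> dist (c (r k) j) (b j)"
    using infinite_enumerate by (metis (mono_tags, lifting) mem_Collect_eq)
  define D :: "('i \<Rightarrow> real) set" where "D = Pi\<^sub>E UNIV (\<lambda>i. if i \<in> I then {-M..M} else {0})"
  have "compactin (product_topology (\<lambda>_. euclidean) UNIV) D"
    unfolding D_def by (subst compactin_PiE) auto
  then have "seq_compact D"
    by (simp add: euclidean_product_topology compact_eq_seq_compact_metric)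
  moreover define c' where "c' k i = (if i \<in> I then c (r k) i else 0)" for k i
  have "\<forall>k. c' k \<in> D" using bd by (auto simp: D_def c'_def abs_le_iff minus_le_iff)
  ultimately obtain l s where ls: "strict_mono (s :: nat \<Rightarrow> nat)" "(c' \<circ> s) \<longlonglongrightarrow> l"
    unfolding seq_compact_def by metis
  have coord: "(\<lambda>k. c (r (s k)) i) \<longlonglongrightarrow> l i" if "i \<in> I" for i
  proof -
    have "(\<lambda>k. (c' \<circ> s) k i) \<longlonglongrightarrow> l i"
      using ls(2) continuous_on_tendsto_compose[OF continuous_on_product_coordinates] by fastforce
    then show ?thesis using that by (simp add: c'_def)
  qed
  then have "(\<lambda>k. \<Sum>i\<in>I. c (r (s k)) i *\<^sub>R x i) \<longlonglongrightarrow> (\<Sum>i\<in>I. l i *\<^sub>R x i)"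
    by (intro tendsto_intros) auto
  moreover have "(\<lambda>k. \<Sum>i\<in>I. c (r (s k)) i *\<^sub>R x i) \<longlonglongrightarrow> (\<Sum>i\<in>I. b i *\<^sub>R x i)"
    using LIMSEQ_subseq_LIMSEQ[OF lim, of "r \<circ> s"] r(1) ls(1) strict_mono_o by (fastforce simp: o_def)
  ultimately have "(\<Sum>i\<in>I. l i *\<^sub>R x i) = (\<Sum>i\<in>I. b i *\<^sub>R x i)"
    by (rule LIMSEQ_unique)
  then have "l j = b j" using independent_coefficients_eq[OF I] j by blast
  then have "(\<lambda>k. dist (c (r (s k)) j) (b j)) \<longlonglongrightarrow> 0"
    using coord[OF j] tendsto_dist_iff by fastforce
  then have "e \<le> 0" using r(2) by (intro LIMSEQ_le_const) auto
  then show False using e by simp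
qed

text \<open>\<open>W i\<close> is a weak* open set whose trace on \<open>Ext_closure G\<close> lies
  in \<open>Ub i\<close>; in this form the neighbourhoods apply directly to weak* convergent
  sequences.\<close>

locale sparse_source = sparse_problem F K G
  for F :: "'y::{real_inner, complete_space} \<Rightarrow> real"
    and K :: "('c::banach \<Rightarrow>\<^sub>L real) \<Rightarrow> 'y"
    and G :: "('c \<Rightarrow>\<^sub>L real) \<Rightarrow> ennreal" +
  fixes ubar :: "'c \<Rightarrow>\<^sub>L real" and N :: nat and ub :: "nat \<Rightarrow> ('c \<Rightarrow>\<^sub>L real)"
    and Ny :: "'y set" and \<theta> :: real
    and g :: "('c \<Rightarrow>\<^sub>L real) \<Rightarrow> ('c \<Rightarrow>\<^sub>L real) \<Rightarrow> real" and \<tau> \<kappa> :: real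
    and Ub W :: "nat \<Rightarrow> ('c \<Rightarrow>\<^sub>L real) set"
  assumes ubar: "minimizer ubar"
    and Ny: "K ubar \<in> interior Ny" and \<theta>: "0 < \<theta>"
    and strongly_monotone: "\<And>y1 y2. y1 \<in> Ny \<Longrightarrow> y2 \<in> Ny \<Longrightarrow>
         \<theta> * (norm (y1 - y2))\<^sup>2 \<le> inner (gradient F y1 - gradient F y2) (y1 - y2)"
    and N: "N \<ge> 1" and ub_inj: "inj_on ub {1..N}" and ub_Ext: "ub ` {1..N} \<subseteq> Ext G"
    and dual_le: "\<And>w. w \<in> Ext_closure G \<Longrightarrow> blinfun_apply w (dual_var F K ubar) \<le> 1"
    and dual_eq: "{w \<in> Ext_closure G. blinfun_apply w (dual_var F K ubar) = 1} = ub ` {1..N}"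
    and Kub_inj: "inj_on (\<lambda>i. K (ub i)) {1..N}"
    and Kub_independent: "independent ((\<lambda>i. K (ub i)) ` {1..N})"
    and coefficients_pos: "\<And>lam :: nat \<Rightarrow> real. (\<forall>i\<in>{1..N}. 0 \<le> lam i) \<Longrightarrow> ubar = (\<Sum>i=1..N. lam i *\<^sub>R ub i)
                \<Longrightarrow> \<forall>i\<in>{1..N}. 0 < lam i"
    and \<tau>: "0 < \<tau>" and \<kappa>: "0 < \<kappa>"
    and g_nonneg: "\<And>w w'. w \<in> Ext G \<Longrightarrow> w' \<in> Ext G \<Longrightarrow> 0 \<le> g w w'"
    and Ub_disjoint: "disjoint_family_on Ub {1..N}"
    and W_open: "\<And>i. i \<in> {1..N} \<Longrightarrow> openin weak_star (W i)"
    and W_mem: "\<And>i. i \<in> {1..N} \<Longrightarrow> ub i \<in> W i"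
    and W_subset: "\<And>i. i \<in> {1..N} \<Longrightarrow> W i \<inter> Ext_closure G \<subseteq> Ub i"
    and growth_K: "\<And>i w. i \<in> {1..N} \<Longrightarrow> w \<in> Ub i \<inter> Ext G \<Longrightarrow> norm (K (w - ub i)) \<le> \<tau> * g w (ub i)"
    and growth_dual: "\<And>i w. i \<in> {1..N} \<Longrightarrow> w \<in> Ub i \<inter> Ext G \<Longrightarrow>
      \<kappa> * (g w (ub i))\<^sup>2 \<le> 1 - blinfun_apply w (dual_var F K ubar)"
begin

lemma Ext_subset_closure: "Ext G \<subseteq> Ext_closure G"
  unfolding Ext_closure_def by (rule closure_of_subset) (simp add: strong_operator_topology_topspace)

lemma dual_ub: "i \<in> {1..N} \<Longrightarrow> blinfun_apply (ub i) (dual_var F K ubar) = 1"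
  using dual_eq by blast

text \<open>All minimizers share \<open>K w\<close> and thus the dual variable. Divided by its
  \<open>Gr\<close>, a nonzero minimizer lies in the face of \<open>B\<close> where this variable
  attains 1, and the extreme points of that face are among the \<open>ub i\<close>. Convex weights
  sum to 1, so the coefficients sum to \<open>Gr w\<close>.\<close>

lemma minimizer_representation:
  assumes w: "minimizer w"
  obtains lam where "\<And>i. i \<in> {1..N} \<Longrightarrow> 0 \<le> lam i" "w = (\<Sum>i=1..N. lam i *\<^sub>R ub i)"
    "Gr w = (\<Sum>i=1..N. lam i)"
proof (cases "w = 0")
  case True
  then show ?thesis using that[of "\<lambda>_. 0"] by (simp add: Gr_def)
next
  case False
  have fin: "G w < \<infinity>" using w by (simp add: minimizer_def)
  define p where "p = dual_var F K ubar"
  have p: "p = dual_var F K w"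
    unfolding p_def dual_var_def using minimizer_K_unique[OF w ubar] by simp
  have le: "blinfun_apply v p \<le> 1" if "v \<in> B" for v
    using le_on_B_if_le_on_Ext[OF _ that] dual_le Ext_subset_closure unfolding p_def by blast
  define x where "x = (1 / Gr w) *\<^sub>R w"
  have x: "0 < Gr w" "x \<in> B"
    using normalized_in_B[OF fin False] by (auto simp: x_def)
  have px: "blinfun_apply x p = 1"
    using x(1) minimizer_optimality(2)[OF w fin] by (simp add: x_def p blinfun.scaleR_left)
  have face: "max_face p B face_of B" using max_face_face_of B_convex by blast
  have "max_face p B \<subseteq> convex hull (ub ` {1..N})"
  proof (rule Krein_Milman_finite[OF separable compactin_max_face[OF B_compact] face_of_imp_convex[OF face]])
    fix e assume "e extreme_point_of max_face p B"
    then have e: "e extreme_point_of B" "e \<in> max_face p B"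
      using extreme_point_of_face[OF face] by auto
    then have "1 \<le> blinfun_apply e p" using x px by (auto simp: max_face_def)
    moreover have "e \<in> Ext G" using e by (simp add: Ext_def)
    ultimately show "e \<in> ub ` {1..N}"
      using le[of e] Ext_subset_B Ext_subset_closure unfolding dual_eq[symmetric] p_def by force
  qed simp
  moreover have "x \<in> max_face p B" using x px le by (auto simp: max_face_def)
  ultimately obtain c where c: "\<forall>z\<in>ub ` {1..N}. 0 \<le> c z" "sum c (ub ` {1..N}) = 1" "(\<Sum>z\<in>ub ` {1..N}. c z *\<^sub>R z) = x"
    unfolding convex_hull_finite[OF finite_imageI[OF finite_atLeastAtMost]] by auto
  have "w = Gr w *\<^sub>R x" using x by (simp add: x_def)
  also have "x = (\<Sum>i=1..N. c (ub i) *\<^sub>R ub i)"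
    unfolding c(3)[symmetric] by (subst sum.reindex[OF ub_inj]) simp
  finally have "w = (\<Sum>i=1..N. (Gr w * c (ub i)) *\<^sub>R ub i)"
    by (simp add: scaleR_sum_right)
  moreover have "Gr w = (\<Sum>i=1..N. Gr w * c (ub i))"
    using c(2) unfolding sum.reindex[OF ub_inj] by (simp add: sum_distrib_left[symmetric])
  ultimately show ?thesis
    using that[of "\<lambda>i. Gr w * c (ub i)"] c(1) by simp
qed

lemma minimizer_unique: "minimizer w \<longleftrightarrow> w = ubar"
proof
  assume w: "minimizer w"
  obtain a where a: "w = (\<Sum>i=1..N. a i *\<^sub>R ub i)" using minimizer_representation[OF w] by metis
  obtain b where b: "ubar = (\<Sum>i=1..N. b i *\<^sub>R ub i)" using minimizer_representation[OF ubar] by metis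
  have "(\<Sum>i=1..N. a i *\<^sub>R K (ub i)) = (\<Sum>i=1..N. b i *\<^sub>R K (ub i))"
    using minimizer_K_unique[OF w ubar] unfolding a b by (simp add: K.sum K.scaleR)
  then have "a i = b i" if "i \<in> {1..N}" for i
    using independent_coefficients_eq[OF _ Kub_inj Kub_independent] that by blast
  then show "w = ubar" unfolding a b by simp
qed (use ubar in simp)

lemma ubar_representation:
  obtains lam where "\<And>i. i \<in> {1..N} \<Longrightarrow> 0 < lam i" "ubar = (\<Sum>i=1..N. lam i *\<^sub>R ub i)"
    "Gr ubar = (\<Sum>i=1..N. lam i)"
proof -
  obtain lam where lam: "\<And>i. i \<in> {1..N} \<Longrightarrow> 0 \<le> lam i" "ubar = (\<Sum>i=1..N. lam i *\<^sub>R ub i)"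
    "Gr ubar = (\<Sum>i=1..N. lam i)"
    using minimizer_representation[OF ubar] by blast
  then have "\<forall>i\<in>{1..N}. 0 < lam i" by (intro coefficients_pos) auto
  then show thesis using that lam by blast
qed

lemma Gr_ubar_pos: "0 < Gr ubar"
proof -
  obtain lam where "\<And>i. i \<in> {1..N} \<Longrightarrow> 0 < lam i" "Gr ubar = (\<Sum>i=1..N. lam i)"
    using ubar_representation by blast
  then show ?thesis using N by (auto intro!: sum_pos)
qed

text \<open>Every subsequence has a weak* convergent further one, whose limit is a minimizer and
  hence \<open>ubar\<close>.\<close>

lemma minimizing_sequence_tendsto:
  assumes fin: "\<And>n. G (w n) < \<infinity>" and lim: "(\<lambda>n. obj (w n)) \<longlonglongrightarrow> obj ubar"
  shows "limitin weak_star w ubar sequentially"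
  unfolding limitin_def
proof (intro conjI allI impI)
  show "ubar \<in> topspace weak_star" by (simp add: strong_operator_topology_topspace)
  fix U assume U: "openin weak_star U \<and> ubar \<in> U"
  show "\<forall>\<^sub>F k in sequentially. w k \<in> U"
  proof (rule ccontr)
    assume "\<not> ?thesis"
    then have "infinite {k. w k \<notin> U}"
      unfolding eventually_sequentially infinite_nat_iff_unbounded_le by auto
    then obtain r :: "nat \<Rightarrow> nat" where r: "strict_mono r" "\<And>k. w (r k) \<notin> U"
      using infinite_enumerate by (metis (mono_tags, lifting) mem_Collect_eq)
    have "(\<lambda>n. obj (w (r n))) \<longlonglongrightarrow> obj ubar"
      using LIMSEQ_subseq_LIMSEQ[OF lim r(1)] by (simp add: o_def)
    then obtain l s where ls: "strict_mono (s :: nat \<Rightarrow> nat)" "limitin weak_star ((\<lambda>n. w (r n)) \<circ> s) l sequentially"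
      "G l < \<infinity>" "obj l \<le> obj ubar"
      using minimizing_sequence_limit[of "\<lambda>n. w (r n)" "obj ubar"] fin by blast
    then have "minimizer l" using ubar unfolding minimizer_def by force
    then have "l = ubar" using minimizer_unique by blast
    then have "\<forall>\<^sub>F k in sequentially. w (r (s k)) \<in> U"
      using ls(2) U unfolding limitin_def by simp
    then show False using r(2) by simp
  qed
qed

end

section \<open>Linear convergence\<close>

text \<open>An infinite run from its second iterate on, with shifted indices: the first pass is never
  preceded by a minimization over coefficients, so the optimality relations in \<open>active\<close> are
  available only afterwards.\<close>

locale fcgcg_tail = sparse_source F K G ubar N ub Ny \<theta> g \<tau> \<kappa> Ub W
  for F :: "'y::{real_inner, complete_space} \<Rightarrow> real"
    and K :: "('c::banach \<Rightarrow>\<^sub>L real) \<Rightarrow> 'y"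
    and G :: "('c \<Rightarrow>\<^sub>L real) \<Rightarrow> ennreal"
    and ubar N ub Ny \<theta> g \<tau> \<kappa> Ub W +
  fixes A :: "nat \<Rightarrow> ('c \<Rightarrow>\<^sub>L real) set" and u :: "nat \<Rightarrow> ('c \<Rightarrow>\<^sub>L real)"
    and l :: "nat \<Rightarrow> ('c \<Rightarrow>\<^sub>L real) \<Rightarrow> real" and v :: "nat \<Rightarrow> ('c \<Rightarrow>\<^sub>L real)"
  assumes active: "\<And>k. active (A k) (u k) (l k)"
    and pass: "\<And>k. pass (A k) (u k) (u (Suc k)) (v k)"
begin

lemma candidate: "v k \<in> candidates F K G (u k)"
  and not_stopped: "1 < blinfun_apply (v k) (dual_var F K (u k))"
  and step_value: "(\<And>a. a \<in> A k \<Longrightarrow> 0 \<le> l' a) \<Longrightarrow> 0 \<le> b \<Longrightarrow>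
    val (u (Suc k)) \<le> F ((\<Sum>a\<in>A k. l' a *\<^sub>R K a) + b *\<^sub>R K (v k)) + ((\<Sum>a\<in>A k. l' a) + b)"
  using pass[of k] unfolding pass_def by blast+

definition mass where "mass k = (\<Sum>a\<in>A k. l k a)"

text \<open>The quantity \<Phi> of the overview.\<close>

definition gap where "gap k = blinfun_apply (v k) (dual_var F K (u k)) - 1"

definition res where "res k = val (u k) - obj ubar"

definition Finf where "Finf = Inf (range F)"

text \<open>Since \<open>val\<close> does not increase along the run and \<open>F\<close> is at
  least \<open>Finf\<close>, this bounds the masses of all iterates and also
  \<open>Gr ubar\<close>.\<close>

definition Mbd where "Mbd = val (u 0) - Finf"

lemma Finf_le: "Finf \<le> F y"
  unfolding Finf_def by (rule cInf_lower[OF _ F_bdd]) simp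

lemma gap_pos: "0 < gap k"
  using not_stopped by (simp add: gap_def)

lemma v_Ext: "v k \<in> Ext G"
  using candidatesD(1)[OF candidate] .

lemma pair_le_gap: "w \<in> Ext G \<Longrightarrow> blinfun_apply w (dual_var F K (u k)) \<le> 1 + gap k"
  using candidatesD(2)[OF candidate] by (simp add: gap_def)

lemma u_mass: "blinfun_apply (u k) (dual_var F K (u k)) = mass k" "G (u k) \<le> ennreal (mass k)" "0 \<le> mass k"
  using activeD(6-8)[OF active] by (auto simp: mass_def)

lemma val_mass: "val (u k) = F (K (u k)) + mass k"
  by (simp add: val_def u_mass)

lemma G_u_finite: "G (u k) < \<infinity>"
  using G_finite u_mass(2) by blast

lemma K_u: "K (u k) = (\<Sum>a\<in>A k. l k a *\<^sub>R K a)"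
  by (subst activeD(4)[OF active]) (rule K_sum)

lemma l_nonneg: "a \<in> A k \<Longrightarrow> 0 \<le> l k a"
  using activeD(3)[OF active] less_imp_le by blast

lemma res_nonneg: "0 \<le> res k"
  using ubar active_obj_le_val[OF active, of k] G_u_finite[of k] unfolding res_def minimizer_def by force

lemma res_decreasing: "res (Suc k) \<le> res k"
  using step_value[where k = k and l' = "l k" and b = 0] l_nonneg
  by (simp add: res_def val_mass mass_def K_u)

lemma res_antimono: "decseq res"
  using res_decreasing decseq_Suc_iff by blast

lemma mass_le: "mass k \<le> Mbd"
proof -
  have "res k \<le> res 0" using res_antimono by (simp add: decseq_def)
  then show ?thesis using Finf_le[of "K (u k)"] by (simp add: res_def val_mass[of k] Mbd_def)
qed

lemma Gr_ubar_le: "Gr ubar \<le> Mbd"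
  using res_nonneg[of 0] Finf_le[of "K ubar"] by (simp add: res_def obj_def Mbd_def)

lemma Mbd_pos: "0 < Mbd"
  using Gr_ubar_le Gr_ubar_pos by linarith

lemma ubar_finite: "G ubar < \<infinity>"
  using ubar by (simp add: minimizer_def)

lemma pair_ubar_le: "blinfun_apply ubar (dual_var F K (u k)) \<le> (1 + gap k) * Gr ubar"
  using le_Gr_if_le_on_Ext[OF pair_le_gap _ ubar_finite] gap_pos[of k] by simp

text \<open>The tangent of \<open>F\<close> at \<open>K (u k)\<close> bounds the residual by the
  current pairing of \<open>ubar\<close> minus \<open>Gr ubar\<close>, and pairings with extremal
  points are at most \<open>1 + gap k\<close>.\<close>

lemma res_le_gap: "res k \<le> Mbd * gap k"
proof -
  have "res k \<le> blinfun_apply ubar (dual_var F K (u k)) - Gr ubar"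
    using F_above[of "K (u k)" "K ubar"] by (simp add: res_def val_def obj_def dual_var inner_simps)
  also have "\<dots> \<le> gap k * Gr ubar" using pair_ubar_le[of k] by (simp add: algebra_simps)
  also have "\<dots> \<le> Mbd * gap k"
    using Gr_ubar_le gap_pos[of k] by (simp add: mult.commute mult_left_mono)
  finally show ?thesis .
qed

section \<open>A compact convex set containing all trial images\<close>

definition Q where "Q = K ` {w. G w \<le> ennreal Mbd}"

lemma Q_compact: "compact Q"
  unfolding Q_def using K_image_compact Mbd_pos by simp

lemma Q_convex: "convex Q"
  unfolding Q_def using convex_linear_image[OF K_linear convex_sublevel] .

lemma K_u_Q: "K (u k) \<in> Q"
  unfolding Q_def using u_mass(2)[of k] mass_le[of k] order_trans[OF _ ennreal_leI] by blast

lemma K_ubar_Q: "K ubar \<in> Q"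
  unfolding Q_def using G_eq_Gr[OF ubar_finite] Gr_ubar_le by (auto intro!: imageI ennreal_leI)

lemma Q_sum:
  assumes "finite I" "\<And>i. i \<in> I \<Longrightarrow> 0 \<le> c i" "\<And>i. i \<in> I \<Longrightarrow> w i \<in> Ext G" "(\<Sum>i\<in>I. c i) \<le> Mbd"
  shows "(\<Sum>i\<in>I. c i *\<^sub>R K (w i)) \<in> Q"
proof -
  have "G (\<Sum>i\<in>I. c i *\<^sub>R w i) \<le> ennreal (\<Sum>i\<in>I. c i)"
    using assms Ext_G_le by (intro G_sum) auto
  also have "\<dots> \<le> ennreal Mbd" using assms(4) by (rule ennreal_leI)
  finally show ?thesis
    unfolding Q_def by (intro image_eqI[of _ _ "\<Sum>i\<in>I. c i *\<^sub>R w i"]) (auto simp: K.sum K.scaleR)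
qed

definition Lip where "Lip = (SOME L. L-lipschitz_on Q (gradient F))"

lemma Lip: "Lip-lipschitz_on Q (gradient F)"
  unfolding Lip_def by (rule someI_ex) (rule F_lipschitz[OF Q_compact])

lemma Lip_nonneg: "0 \<le> Lip"
  using lipschitz_on_nonneg[OF Lip] .

lemma gradient_lipschitz: "y \<in> Q \<Longrightarrow> z \<in> Q \<Longrightarrow> norm (gradient F y - gradient F z) \<le> Lip * norm (y - z)"
  using lipschitz_onD[OF Lip] by (simp add: dist_norm)

lemma F_descent:
  assumes "y \<in> Q" "y + h \<in> Q"
  shows "F (y + h) \<le> F y + inner h (gradient F y) + Lip * (norm h)\<^sup>2"
  using convex_on_descent[OF F_convex F_diff] gradient_lipschitz[OF assms(2,1)] by simp

definition Dia where "Dia = diameter Q"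

lemma Q_dist: "y \<in> Q \<Longrightarrow> z \<in> Q \<Longrightarrow> norm (y - z) \<le> Dia"
  using diameter_bounded_bound[OF compact_imp_bounded[OF Q_compact]] by (simp add: Dia_def dist_norm)

text \<open>The classical conditional gradient step towards \<open>Mbd\<close> times the new extremal point.\<close>

lemma res_global_step:
  assumes s: "0 \<le> s" "s \<le> 1"
  shows "res (Suc k) \<le> res k - s * res k + Lip * Dia\<^sup>2 * s\<^sup>2"
proof -
  define h where "h = s *\<^sub>R (Mbd *\<^sub>R K (v k) - K (u k))"
  have v_Q: "Mbd *\<^sub>R K (v k) \<in> Q"
    using Q_sum[of "{()}" "\<lambda>_. Mbd" "\<lambda>_. v k"] Mbd_pos v_Ext by simp
  have eq: "K (u k) + h = (1 - s) *\<^sub>R K (u k) + s *\<^sub>R (Mbd *\<^sub>R K (v k))"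
    by (simp add: h_def algebra_simps)
  have h_Q: "K (u k) + h \<in> Q"
    unfolding eq using convexD_alt[OF Q_convex K_u_Q v_Q s] .
  have "(norm h)\<^sup>2 \<le> (s * Dia)\<^sup>2"
    unfolding h_def using Q_dist[OF v_Q K_u_Q] s by (intro power_mono) (auto intro: mult_left_mono)
  then have h2: "Lip * (norm h)\<^sup>2 \<le> Lip * (s * Dia)\<^sup>2" using Lip_nonneg by (rule mult_left_mono)
  \<comment> \<open>Adding the change of mass \<open>s * (Mbd - mass k)\<close> leaves the
    first-order decrease \<open>s * Mbd * gap k\<close>, at least \<open>s * res k\<close>.\<close>
  have grad: "inner h (gradient F (K (u k))) = s * (mass k - Mbd * (1 + gap k))"
  proof -
    have "inner (K (u k)) (gradient F (K (u k))) = - mass k"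
      using u_mass(1)[of k] by (simp add: dual_var)
    then show ?thesis by (simp add: h_def gap_def dual_var inner_simps algebra_simps)
  qed
  have "val (u (Suc k)) \<le> F ((\<Sum>a\<in>A k. ((1 - s) * l k a) *\<^sub>R K a) + (s * Mbd) *\<^sub>R K (v k))
      + ((\<Sum>a\<in>A k. (1 - s) * l k a) + s * Mbd)"
    using s l_nonneg Mbd_pos by (intro step_value) auto
  also have "(\<Sum>a\<in>A k. ((1 - s) * l k a) *\<^sub>R K a) + (s * Mbd) *\<^sub>R K (v k) = K (u k) + h"
    unfolding eq by (simp add: K_u scaleR_sum_right)
  also have "(\<Sum>a\<in>A k. (1 - s) * l k a) = (1 - s) * mass k"
    by (simp add: mass_def sum_distrib_left)
  finally have "val (u (Suc k)) \<le> F (K (u k) + h) + ((1 - s) * mass k + s * Mbd)" .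
  also have "\<dots> \<le> val (u k) - s * (Mbd * gap k) + Lip * (s * Dia)\<^sup>2"
    using F_descent[OF K_u_Q h_Q] h2 grad by (simp add: val_mass algebra_simps)
  also have "\<dots> \<le> val (u k) - s * res k + Lip * (s * Dia)\<^sup>2"
    using mult_left_mono[OF res_le_gap s(1), of k] by simp
  finally show ?thesis by (simp add: res_def power_mult_distrib algebra_simps)
qed

text \<open>The limit \<open>r\<close> of the residuals inherits
  \<open>s * r \<le> E * s\<^sup>2\<close> for each fixed \<open>s\<close> between 0 and 1; a small
  \<open>s\<close> excludes \<open>r > 0\<close>.\<close>

lemma res_tendsto_0: "res \<longlonglongrightarrow> 0"
proof -
  obtain r where r: "res \<longlonglongrightarrow> r" "\<And>k. r \<le> res k"
    using decseq_convergent[OF res_antimono, of 0] res_nonneg by blast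
  have r0: "0 \<le> r" using LIMSEQ_le_const[OF r(1), of 0] res_nonneg by blast
  define E where "E = Lip * Dia\<^sup>2"
  have E: "0 \<le> E" using Lip_nonneg by (simp add: E_def)
  have ineq: "s * r \<le> E * s\<^sup>2" if s: "0 \<le> s" "s \<le> 1" for s
  proof -
    have "(\<lambda>k. res (Suc k)) \<longlonglongrightarrow> r" using r(1) by (rule LIMSEQ_Suc)
    moreover have "(\<lambda>k. res k - s * res k + E * s\<^sup>2) \<longlonglongrightarrow> r - s * r + E * s\<^sup>2"
      by (intro tendsto_intros r)
    ultimately have "r \<le> r - s * r + E * s\<^sup>2"
      by (rule LIMSEQ_le) (use res_global_step[OF s] in \<open>auto simp: E_def\<close>)
    then show ?thesis by simp
  qed
  have "r \<le> 0"
  proof (rule ccontr)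
    assume "\<not> r \<le> 0"
    define s where "s = min 1 (r / (2 * (E + 1)))"
    have s: "0 < s" "s \<le> 1" using \<open>\<not> r \<le> 0\<close> E by (auto simp: s_def)
    have "s \<le> r / (2 * (E + 1))" by (simp add: s_def)
    then have "s * (2 * (E + 1)) \<le> r" using E by (simp add: pos_le_divide_eq)
    moreover have "0 \<le> s * E" using s E by simp
    moreover have "s * (2 * (E + 1)) = 2 * (s * E) + 2 * s" by (simp add: algebra_simps)
    ultimately have "s * E < r" using s by linarith
    then have "s * (s * E) < s * r" using s by simp
    then show False using ineq[of s] s by (simp add: power2_eq_square algebra_simps)
  qed
  then show ?thesis using r r0 by simp
qed

lemma u_tendsto: "limitin weak_star u ubar sequentially"
proof (rule minimizing_sequence_tendsto)
  show "(\<lambda>n. obj (u n)) \<longlonglongrightarrow> obj ubar"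
  proof (rule tendsto_sandwich[where f = "\<lambda>_. obj ubar" and h = "\<lambda>n. res n + obj ubar"])
    show "(\<lambda>n. res n + obj ubar) \<longlonglongrightarrow> obj ubar"
      using tendsto_add[OF res_tendsto_0 tendsto_const, of "obj ubar"] by simp
    show "\<forall>\<^sub>F n in sequentially. obj ubar \<le> obj (u n)"
      using ubar G_u_finite by (simp add: minimizer_def)
    show "\<forall>\<^sub>F n in sequentially. obj (u n) \<le> res n + obj ubar"
      using active_obj_le_val[OF active] by (simp add: res_def)
  qed simp
qed (rule G_u_finite)

lemma K_u_tendsto: "(\<lambda>k. K (u k)) \<longlonglongrightarrow> K ubar"
  using K_strong[OF G_u_finite u_tendsto] .

section \<open>Dual errors and the location of active and new points\<close>

definition err where "err k = norm (gradient F (K (u k)) - gradient F (K ubar))"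

lemma err_nonneg: "0 \<le> err k" by (simp add: err_def)

lemma err_le: "err k \<le> Lip * norm (K (u k) - K ubar)"
  unfolding err_def using gradient_lipschitz[OF K_u_Q K_ubar_Q] .

lemma err_tendsto_0: "err \<longlonglongrightarrow> 0"
proof (rule tendsto_sandwich[of "\<lambda>_. 0"])
  have "(\<lambda>k. Lip * norm (K (u k) - K ubar)) \<longlonglongrightarrow> Lip * norm (K ubar - K ubar)"
    by (intro tendsto_intros K_u_tendsto)
  then show "(\<lambda>k. Lip * norm (K (u k) - K ubar)) \<longlonglongrightarrow> 0" by simp
qed (use err_nonneg err_le in auto)

lemma dual_diff_le:
  "blinfun_apply w (dual_var F K (u k)) - blinfun_apply w (dual_var F K ubar) \<le> err k * norm (K w)"
proof -
  have "blinfun_apply w (dual_var F K (u k)) - blinfun_apply w (dual_var F K ubar)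
    = inner (- K w) (gradient F (K (u k)) - gradient F (K ubar))"
    by (simp add: dual_var inner_simps)
  also have "\<dots> \<le> norm (- K w) * err k"
    unfolding err_def by (rule norm_cauchy_schwarz)
  finally show ?thesis by (simp add: mult.commute)
qed

definition KB where "KB = (SOME C. \<forall>w\<in>Ext G. norm (K w) \<le> C)"

lemma KB: "w \<in> Ext G \<Longrightarrow> norm (K w) \<le> KB"
proof -
  have "bounded (K ` {w. G w \<le> ennreal 1})"
    using K_image_compact[of 1] compact_imp_bounded by simp
  then obtain C where "\<forall>y\<in>K ` {w. G w \<le> ennreal 1}. norm y \<le> C" unfolding bounded_iff by blast
  then have "\<forall>w\<in>Ext G. norm (K w) \<le> C" using Ext_G_le by simp
  then have "\<forall>w\<in>Ext G. norm (K w) \<le> KB" unfolding KB_def by (rule someI)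
  then show "w \<in> Ext G \<Longrightarrow> norm (K w) \<le> KB" by blast
qed

lemma KB_nonneg: "0 \<le> KB"
  using KB[OF v_Ext[of 0]] norm_ge_zero order_trans by blast

text \<open>The inner product splits into two brackets, at most
  \<open>(1 + gap k) * Gr ubar - mass k\<close> and \<open>mass k - Gr ubar\<close>; the masses
  cancel and \<open>gap k * Gr ubar\<close> remains.\<close>

lemma strong_monotonicity_gap:
  "\<forall>\<^sub>F k in sequentially. \<theta> * (norm (K (u k) - K ubar))\<^sup>2 \<le> Mbd * gap k"
proof -
  have "\<forall>\<^sub>F k in sequentially. K (u k) \<in> interior Ny"
    using topological_tendstoD[OF K_u_tendsto open_interior Ny] .
  then show ?thesis
  proof (rule eventually_mono)
    fix k assume "K (u k) \<in> interior Ny"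
    then have "\<theta> * (norm (K (u k) - K ubar))\<^sup>2 \<le>
        inner (gradient F (K (u k)) - gradient F (K ubar)) (K (u k) - K ubar)"
      using strongly_monotone Ny interior_subset by blast
    also have "\<dots> = blinfun_apply ubar (dual_var F K (u k)) - mass k
        + (blinfun_apply (u k) (dual_var F K ubar) - Gr ubar)"
      using u_mass(1)[of k] minimizer_optimality(2)[OF ubar ubar_finite]
      by (simp add: dual_var inner_simps inner_commute)
    also have "\<dots> \<le> gap k * Gr ubar"
      using pair_ubar_le[of k] minimizer_optimality(1)[OF ubar G_u_finite, of k] Gr_le[OF u_mass(3,2), of k]
      by (simp add: algebra_simps)
    also have "\<dots> \<le> Mbd * gap k"
      using Gr_ubar_le gap_pos[of k] by (simp add: mult.commute mult_left_mono)
    finally show "\<theta> * (norm (K (u k) - K ubar))\<^sup>2 \<le> Mbd * gap k" .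
  qed
qed

text \<open>Otherwise exceptional points for infinitely many \<open>k\<close> have a weak* limit
  point in \<open>Ext_closure G\<close> with limiting pairing at least 1. It is one of the
  \<open>ub i\<close>, so they enter \<open>W i\<close>. Replacing the dual variable by its limit
  costs at most \<open>err * KB\<close>.\<close>

lemma localization:
  "\<forall>\<^sub>F k in sequentially. \<forall>w\<in>Ext G. 1 \<le> blinfun_apply w (dual_var F K (u k)) \<longrightarrow> (\<exists>i\<in>{1..N}. w \<in> Ub i)"
proof (rule ccontr)
  define bad where "bad k w \<longleftrightarrow> w \<in> Ext G \<and> 1 \<le> blinfun_apply w (dual_var F K (u k)) \<and> (\<forall>i\<in>{1..N}. w \<notin> Ub i)" for k w
  assume "\<not> ?thesis"
  then have "infinite {k. \<exists>w. bad k w}"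
    unfolding eventually_sequentially infinite_nat_iff_unbounded_le bad_def by fastforce
  then obtain r :: "nat \<Rightarrow> nat" where r: "strict_mono r" "\<And>k. \<exists>w. bad (r k) w"
    using infinite_enumerate[of "{k. \<exists>w. bad k w}"] by auto
  then obtain w where w: "\<And>k. bad (r k) (w k)" by metis
  then have w_Ext: "w k \<in> Ext G" for k by (simp add: bad_def)
  then have "w k \<in> B" for k using Ext_subset_B by blast
  then obtain x s where s: "x \<in> B" "strict_mono s" "limitin weak_star (w \<circ> s) x sequentially"
    using weak_star_seq_compact[OF separable B_compact, of w] by blast
  have x_closure: "x \<in> Ext_closure G"
  proof (rule limitin_closedin[OF s(3)])
    show "closedin weak_star (Ext_closure G)" by (simp add: Ext_closure_def)
    show "\<forall>\<^sub>F n in sequentially. (w \<circ> s) n \<in> Ext_closure G"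
      using w_Ext Ext_subset_closure by (intro always_eventually) auto
  qed simp
  have "1 \<le> blinfun_apply x (dual_var F K ubar)"
  proof (rule LIMSEQ_le)
    show "(\<lambda>k. blinfun_apply (w (s k)) (dual_var F K ubar)) \<longlonglongrightarrow> blinfun_apply x (dual_var F K ubar)"
      using s(3) by (simp add: limitin_weak_star_iff)
    have "(\<lambda>k. err (r (s k))) \<longlonglongrightarrow> 0"
      using LIMSEQ_subseq_LIMSEQ[OF err_tendsto_0 strict_mono_o[OF r(1) s(2)]] by (simp add: o_def)
    then have "(\<lambda>k. 1 - err (r (s k)) * KB) \<longlonglongrightarrow> 1 - 0 * KB"
      by (intro tendsto_intros)
    then show "(\<lambda>k. 1 - err (r (s k)) * KB) \<longlonglongrightarrow> 1" by simp
    have "1 - err (r (s k)) * KB \<le> blinfun_apply (w (s k)) (dual_var F K ubar)" for k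
      using w[of "s k"] dual_diff_le[of "w (s k)" "r (s k)"] mult_left_mono[OF KB[OF w_Ext] err_nonneg, of "r (s k)" "s k"]
      by (simp add: bad_def)
    then show "\<exists>n. \<forall>k\<ge>n. 1 - err (r (s k)) * KB \<le> blinfun_apply (w (s k)) (dual_var F K ubar)" by blast
  qed
  then have "x \<in> {w \<in> Ext_closure G. blinfun_apply w (dual_var F K ubar) = 1}"
    using dual_le[OF x_closure] x_closure by simp
  then obtain i where i: "i \<in> {1..N}" "x = ub i" unfolding dual_eq by blast
  then have "\<forall>\<^sub>F k in sequentially. (w \<circ> s) k \<in> W i"
    using s(3) W_open[of i] W_mem[of i] unfolding limitin_def by blast
  then obtain k where "w (s k) \<in> W i" by (auto dest: eventually_happens)
  then have "w (s k) \<in> Ub i" using W_subset[OF i(1)] w_Ext Ext_subset_closure by blast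
  then show False using w[of "s k"] i(1) by (simp add: bad_def)
qed

text \<open>A first estimate in terms of \<open>err\<close>, already known to tend to 0; it serves
  to find the limits of the masses near the \<open>ub i\<close>.\<close>

lemma local_distance_err:
  assumes "i \<in> {1..N}" "w \<in> Ub i \<inter> Ext G" "1 \<le> blinfun_apply w (dual_var F K (u k))"
  shows "norm (K w - K (ub i)) \<le> \<tau> * sqrt (err k * KB / \<kappa>)"
proof -
  have "\<kappa> * (g w (ub i))\<^sup>2 \<le> err k * norm (K w)"
    using growth_dual[OF assms(1,2)] dual_diff_le[of w k] assms(3) by linarith
  also have "\<dots> \<le> err k * KB"
    using assms(2) KB err_nonneg by (simp add: mult_left_mono)
  finally have "(g w (ub i))\<^sup>2 \<le> err k * KB / \<kappa>" using \<kappa> by (simp add: field_simps)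
  then have "g w (ub i) \<le> sqrt (err k * KB / \<kappa>)" by (rule real_le_rsqrt)
  then have "\<tau> * g w (ub i) \<le> \<tau> * sqrt (err k * KB / \<kappa>)" using \<tau> by simp
  then show ?thesis using growth_K[OF assms(1,2)] by (simp add: K.diff)
qed

text \<open>The constant that \<open>local_distance_gap\<close> obtains from Young's inequality and
  the bound of \<open>(err k)\<^sup>2\<close> by a multiple of \<open>gap k\<close>.\<close>

definition Cgap where "Cgap = \<tau>\<^sup>2 * (2 * (1 + \<tau>\<^sup>2 * Lip\<^sup>2 * Mbd / (2 * \<kappa> * \<theta>)) / \<kappa>)"

lemma Cgap_nonneg: "0 \<le> Cgap"
  unfolding Cgap_def using \<kappa> \<theta> Mbd_pos by (intro mult_nonneg_nonneg divide_nonneg_pos add_nonneg_nonneg) auto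

text \<open>Comparison with \<open>ub i\<close>, whose current pairing is at most
  \<open>1 + gap k\<close>, lets the dual error act on \<open>w - ub i\<close>. In the resulting
  product \<open>err k * (\<tau> * \<gamma>)\<close>, half of the growth term absorbs
  \<open>\<gamma>\<^sup>2\<close>, and \<open>(err k)\<^sup>2\<close> is of order
  \<open>gap k\<close> by strong monotonicity.\<close>

lemma local_distance_gap:
  "\<forall>\<^sub>F k in sequentially. \<forall>i\<in>{1..N}. \<forall>w\<in>Ub i \<inter> Ext G. 1 \<le> blinfun_apply w (dual_var F K (u k)) \<longrightarrow>
     (norm (K w - K (ub i)))\<^sup>2 \<le> Cgap * gap k"
  using strong_monotonicity_gap
proof (rule eventually_mono, intro ballI impI)
  fix k i w
  assume sm: "\<theta> * (norm (K (u k) - K ubar))\<^sup>2 \<le> Mbd * gap k"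
    and i: "i \<in> {1..N}" and w: "w \<in> Ub i \<inter> Ext G" and pw: "1 \<le> blinfun_apply w (dual_var F K (u k))"
  define \<gamma> where "\<gamma> = g w (ub i)"
  have ub_i: "ub i \<in> Ext G" using ub_Ext i by blast
  have \<gamma>: "0 \<le> \<gamma>" unfolding \<gamma>_def using g_nonneg w ub_i by blast
  have Kw: "norm (K w - K (ub i)) \<le> \<tau> * \<gamma>"
    using growth_K[OF i w] by (simp add: \<gamma>_def K.diff)
  have "(err k)\<^sup>2 \<le> Lip\<^sup>2 * (norm (K (u k) - K ubar))\<^sup>2"
    using power_mono[OF err_le err_nonneg, of k 2] by (simp add: power_mult_distrib)
  also have "\<dots> \<le> Lip\<^sup>2 * (Mbd * gap k / \<theta>)"
    using sm \<theta> by (intro mult_left_mono) (auto simp: field_simps)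
  finally have err2: "(err k)\<^sup>2 \<le> Lip\<^sup>2 * Mbd * gap k / \<theta>" by simp
  have "\<kappa> * \<gamma>\<^sup>2 \<le> 1 - blinfun_apply w (dual_var F K ubar)"
    using growth_dual[OF i w] by (simp add: \<gamma>_def)
  also have "\<dots> \<le> (blinfun_apply (w - ub i) (dual_var F K (u k)) - blinfun_apply (w - ub i) (dual_var F K ubar)) + gap k"
    using pw pair_le_gap[OF ub_i, of k] dual_ub[OF i] by (simp add: blinfun.diff_left)
  also have "\<dots> \<le> err k * (\<tau> * \<gamma>) + gap k"
    using dual_diff_le[of "w - ub i" k] mult_left_mono[OF Kw err_nonneg, of k] by (simp add: K.diff)
  also have "err k * (\<tau> * \<gamma>) \<le> \<kappa> / 2 * \<gamma>\<^sup>2 + \<tau>\<^sup>2 * (err k)\<^sup>2 / (2 * \<kappa>)"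
  proof -
    have "0 \<le> (\<kappa> * \<gamma> - \<tau> * err k)\<^sup>2 / (2 * \<kappa>)" using \<kappa> by simp
    also have "\<dots> = \<kappa> / 2 * \<gamma>\<^sup>2 + \<tau>\<^sup>2 * (err k)\<^sup>2 / (2 * \<kappa>) - err k * (\<tau> * \<gamma>)"
      using \<kappa> by (simp add: power2_eq_square field_simps)
    finally show ?thesis by simp
  qed
  also have "\<tau>\<^sup>2 * (err k)\<^sup>2 / (2 * \<kappa>) \<le> \<tau>\<^sup>2 * (Lip\<^sup>2 * Mbd * gap k / \<theta>) / (2 * \<kappa>)"
    using err2 \<kappa> by (intro divide_right_mono mult_left_mono) auto
  also have "\<tau>\<^sup>2 * (Lip\<^sup>2 * Mbd * gap k / \<theta>) / (2 * \<kappa>) = \<tau>\<^sup>2 * Lip\<^sup>2 * Mbd / (2 * \<kappa> * \<theta>) * gap k"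
    by (simp add: mult_ac)
  finally have "\<kappa> * \<gamma>\<^sup>2 \<le> \<kappa> / 2 * \<gamma>\<^sup>2 + \<tau>\<^sup>2 * Lip\<^sup>2 * Mbd / (2 * \<kappa> * \<theta>) * gap k + gap k"
    by simp
  then have "\<kappa> / 2 * \<gamma>\<^sup>2 \<le> (1 + \<tau>\<^sup>2 * Lip\<^sup>2 * Mbd / (2 * \<kappa> * \<theta>)) * gap k"
    unfolding distrib_right by linarith
  moreover define D where "D = 1 + \<tau>\<^sup>2 * Lip\<^sup>2 * Mbd / (2 * \<kappa> * \<theta>)"
  ultimately have "\<kappa> / 2 * \<gamma>\<^sup>2 \<le> D * gap k" by simp
  from mult_right_mono[OF this, of "2 / \<kappa>"]
  have \<gamma>2: "\<gamma>\<^sup>2 \<le> 2 * D / \<kappa> * gap k"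
    using \<kappa> by (simp add: mult_ac)
  have "(norm (K w - K (ub i)))\<^sup>2 \<le> \<tau>\<^sup>2 * \<gamma>\<^sup>2"
    using power_mono[OF Kw norm_ge_zero, of 2] by (simp add: power_mult_distrib)
  also have "\<dots> \<le> \<tau>\<^sup>2 * (2 * D / \<kappa> * gap k)"
    using \<gamma>2 by (rule mult_left_mono) simp
  finally show "(norm (K w - K (ub i)))\<^sup>2 \<le> Cgap * gap k"
    by (simp add: Cgap_def D_def mult.assoc)
qed

section \<open>The masses near the points \<open>ub i\<close>\<close>

definition lump where "lump k i = (\<Sum>a\<in>A k \<inter> Ub i. l k a)"

lemma lump_nonneg: "0 \<le> lump k i"
  unfolding lump_def using l_nonneg by (intro sum_nonneg) auto

lemma lump_le: "lump k i \<le> Mbd"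
proof -
  have "lump k i \<le> mass k"
    unfolding lump_def mass_def using l_nonneg activeD(1)[OF active] by (intro sum_mono2) auto
  then show ?thesis using mass_le order_trans by blast
qed

text \<open>As the \<open>Ub i\<close> are disjoint and cover \<open>A k\<close>, the sum regroups
  by neighbourhood, and each active point is replaced by its \<open>ub i\<close>.\<close>

lemma lump_sum_distance:
  assumes cover: "A k \<subseteq> (\<Union>i\<in>{1..N}. Ub i)"
  shows "norm (K (u k) - (\<Sum>i=1..N. lump k i *\<^sub>R K (ub i))) \<le> Mbd * (\<tau> * sqrt (err k * KB / \<kappa>))"
proof -
  define e where "e = \<tau> * sqrt (err k * KB / \<kappa>)"
  have e: "0 \<le> e" using \<tau> \<kappa> KB_nonneg err_nonneg by (simp add: e_def)
  have fin: "finite (A k)" using activeD(1)[OF active] .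
  have split: "(\<Sum>a\<in>A k. f a) = (\<Sum>i=1..N. \<Sum>a\<in>A k \<inter> Ub i. f a)" for f :: "('c \<Rightarrow>\<^sub>L real) \<Rightarrow> 'z::comm_monoid_add"
  proof -
    have "A k = (\<Union>i\<in>{1..N}. A k \<inter> Ub i)" using cover by blast
    then have "(\<Sum>a\<in>A k. f a) = (\<Sum>a\<in>(\<Union>i\<in>{1..N}. A k \<inter> Ub i). f a)" by simp
    also have "\<dots> = (\<Sum>i=1..N. \<Sum>a\<in>A k \<inter> Ub i. f a)"
      by (rule sum.UNION_disjoint) (use fin Ub_disjoint in \<open>auto simp: disjoint_family_on_def\<close>)
    finally show ?thesis .
  qed
  have "K (u k) - (\<Sum>i=1..N. lump k i *\<^sub>R K (ub i)) = (\<Sum>i=1..N. \<Sum>a\<in>A k \<inter> Ub i. l k a *\<^sub>R (K a - K (ub i)))"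
    unfolding K_u split lump_def by (simp add: scaleR_sum_left sum_subtractf scaleR_diff_right)
  also have "norm \<dots> \<le> (\<Sum>i=1..N. \<Sum>a\<in>A k \<inter> Ub i. l k a * e)"
  proof (rule order_trans[OF norm_sum], rule sum_mono, rule order_trans[OF norm_sum], rule sum_mono)
    fix i a assume i: "i \<in> {1..N}" and a: "a \<in> A k \<inter> Ub i"
    then have "norm (K a - K (ub i)) \<le> e"
      unfolding e_def using activeD(2)[OF active, of k] activeD(5)[OF active, of a k]
      by (intro local_distance_err) auto
    then show "norm (l k a *\<^sub>R (K a - K (ub i))) \<le> l k a * e"
      using l_nonneg[of a k] a by (simp add: mult_left_mono)
  qed
  also have "\<dots> = mass k * e"
    unfolding mass_def sum_distrib_right by (rule split[symmetric])
  also have "\<dots> \<le> Mbd * e" using mass_le e by (rule mult_right_mono)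
  finally show ?thesis by (simp add: e_def)
qed

text \<open>The regrouped sums converge to \<open>K ubar\<close>, so independence identifies the
  limits as the coefficients of \<open>ubar\<close>.\<close>

lemma lump_tendsto:
  obtains lam where "\<And>i. i \<in> {1..N} \<Longrightarrow> 0 < lam i" "\<And>i. i \<in> {1..N} \<Longrightarrow> (\<lambda>k. lump k i) \<longlonglongrightarrow> lam i"
proof -
  obtain lam where lam: "\<And>i. i \<in> {1..N} \<Longrightarrow> 0 < lam i" "ubar = (\<Sum>i=1..N. lam i *\<^sub>R ub i)"
    using ubar_representation by blast
  have cover: "\<forall>\<^sub>F k in sequentially. A k \<subseteq> (\<Union>i\<in>{1..N}. Ub i)"
    using localization
  proof (rule eventually_mono)
    fix k assume *: "\<forall>w\<in>Ext G. 1 \<le> blinfun_apply w (dual_var F K (u k)) \<longrightarrow> (\<exists>i\<in>{1..N}. w \<in> Ub i)"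
    show "A k \<subseteq> (\<Union>i\<in>{1..N}. Ub i)"
    proof
      fix a assume "a \<in> A k"
      then have "a \<in> Ext G" "blinfun_apply a (dual_var F K (u k)) = 1"
        using activeD(2,5)[OF active] by blast+
      then show "a \<in> (\<Union>i\<in>{1..N}. Ub i)" using * by auto
    qed
  qed
  have "(\<lambda>k. K (u k) - (\<Sum>i=1..N. lump k i *\<^sub>R K (ub i))) \<longlonglongrightarrow> 0"
  proof (rule Lim_null_comparison)
    show "\<forall>\<^sub>F k in sequentially. norm (K (u k) - (\<Sum>i=1..N. lump k i *\<^sub>R K (ub i))) \<le> Mbd * (\<tau> * sqrt (err k * KB / \<kappa>))"
      using cover by (rule eventually_mono) (rule lump_sum_distance)
    have "(\<lambda>k. Mbd * (\<tau> * sqrt (err k * KB / \<kappa>))) \<longlonglongrightarrow> Mbd * (\<tau> * sqrt (0 * KB / \<kappa>))"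
      using \<kappa> by (intro tendsto_intros err_tendsto_0) auto
    then show "(\<lambda>k. Mbd * (\<tau> * sqrt (err k * KB / \<kappa>))) \<longlonglongrightarrow> 0" by simp
  qed
  from tendsto_diff[OF K_u_tendsto this]
  have lim: "(\<lambda>k. \<Sum>i=1..N. lump k i *\<^sub>R K (ub i)) \<longlonglongrightarrow> (\<Sum>i=1..N. lam i *\<^sub>R K (ub i))"
    by (simp add: lam(2) K.sum K.scaleR)
  have "(\<lambda>k. lump k i) \<longlonglongrightarrow> lam i" if "i \<in> {1..N}" for i
    by (rule independent_coefficients_tendsto[OF _ Kub_inj Kub_independent _ lim that, where M = Mbd])
      (use lump_nonneg lump_le in \<open>auto simp: abs_le_iff intro: order_trans[OF _ lump_nonneg] less_imp_le[OF Mbd_pos]\<close>)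
  then show thesis using that lam(1) by blast
qed

lemma lump_lower_bound:
  obtains \<delta> where "0 < \<delta>" "\<forall>\<^sub>F k in sequentially. \<forall>i\<in>{1..N}. \<delta> \<le> lump k i"
proof -
  obtain lam where lam: "\<And>i. i \<in> {1..N} \<Longrightarrow> 0 < lam i" "\<And>i. i \<in> {1..N} \<Longrightarrow> (\<lambda>k. lump k i) \<longlonglongrightarrow> lam i"
    using lump_tendsto by blast
  \<comment> \<open>Half of the smallest limit lies strictly below every limit.\<close>
  define \<delta> where "\<delta> = Min (lam ` {1..N}) / 2"
  have Min: "0 < Min (lam ` {1..N})" using lam(1) N by (subst Min_gr_iff) auto
  have "\<forall>\<^sub>F k in sequentially. \<delta> \<le> lump k i" if i: "i \<in> {1..N}" for i
  proof -
    have "Min (lam ` {1..N}) \<le> lam i" using i by simp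
    then have "\<delta> < lam i" using Min by (simp add: \<delta>_def)
    then have "\<forall>\<^sub>F k in sequentially. \<delta> < lump k i" using order_tendstoD(1)[OF lam(2)[OF i]] by blast
    then show ?thesis by (rule eventually_mono) simp
  qed
  then have "\<forall>\<^sub>F k in sequentially. \<forall>i\<in>{1..N}. \<delta> \<le> lump k i"
    by (simp add: eventually_ball_finite)
  then show thesis using that[of \<delta>] Min by (simp add: \<delta>_def)
qed

text \<open>Moves the fraction \<open>s\<close> of the mass of the active points near \<open>ub i\<close> to the new point,
  which lies near the same \<open>ub i\<close>.  The total mass is unchanged, so the first-order decrease is
  proportional to \<open>gap k\<close>, while the displacement squared is only of the order of \<open>gap k\<close>.\<close>

lemma res_local_step:
  assumes i: "i \<in> {1..N}" "v k \<in> Ub i" and s: "0 \<le> s" "s \<le> 1" "8 * Lip * Cgap * Mbd * s \<le> 1"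
    and dist: "\<And>w. w \<in> Ub i \<inter> Ext G \<Longrightarrow> 1 \<le> blinfun_apply w (dual_var F K (u k)) \<Longrightarrow>
       (norm (K w - K (ub i)))\<^sup>2 \<le> Cgap * gap k"
  shows "res (Suc k) \<le> res k - s * lump k i * gap k / 2"
proof -
  define A' where "A' = A k \<inter> Ub i"
  have fin: "finite (A k)" and A': "finite A'" "A' \<subseteq> A k"
    using activeD(1)[OF active] by (auto simp: A'_def)
  define h where "h = s *\<^sub>R (\<Sum>a\<in>A'. l k a *\<^sub>R (K (v k) - K a))"
  define l' where "l' a = l k a - (if a \<in> A' then s * l k a else 0)" for a
  have l': "0 \<le> l' a" if "a \<in> A k" for a
    using s l_nonneg[OF that] mult_right_mono[OF s(2) l_nonneg[OF that]] by (simp add: l'_def)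
  have restrict: "(\<Sum>a\<in>A k. (if a \<in> A' then s * l k a else 0) *\<^sub>R f a) = s *\<^sub>R (\<Sum>a\<in>A'. l k a *\<^sub>R f a)"
    for f :: "('c \<Rightarrow>\<^sub>L real) \<Rightarrow> 'z::real_vector"
  proof -
    have "(\<Sum>a\<in>A k. (if a \<in> A' then s * l k a else 0) *\<^sub>R f a) = (\<Sum>a\<in>A'. (if a \<in> A' then s * l k a else 0) *\<^sub>R f a)"
      using fin A' by (intro sum.mono_neutral_right) auto
    then show ?thesis by (simp add: scaleR_sum_right)
  qed
  have lump: "lump k i = (\<Sum>a\<in>A'. l k a)" by (simp add: lump_def A'_def)
  have K_eq: "(\<Sum>a\<in>A k. l' a *\<^sub>R K a) + (s * lump k i) *\<^sub>R K (v k) = K (u k) + h"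
    by (simp add: l'_def h_def K_u scaleR_diff_left scaleR_diff_right sum_subtractf restrict lump
        scaleR_sum_left[symmetric] algebra_simps)
  have mass_eq: "(\<Sum>a\<in>A k. l' a) + s * lump k i = mass k"
    using restrict[of "\<lambda>_. 1 :: real"] by (simp add: l'_def sum_subtractf mass_def lump)
  have h_Q: "K (u k) + h \<in> Q"
  proof -
    \<comment> \<open>Explicit weights of total \<open>mass k \<le> Mbd\<close> witness membership
      in \<open>Q\<close>.\<close>
    define c where "c a = (if a \<in> A k then l' a else 0) + (if a = v k then s * lump k i else 0)" for a
    have "(\<Sum>a\<in>insert (v k) (A k). c a *\<^sub>R K a) = K (u k) + h"
      unfolding K_eq[symmetric] c_def by (rule sum_insert_weights[OF fin])
    moreover have "(\<Sum>a\<in>insert (v k) (A k). c a) = mass k"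
      unfolding mass_eq[symmetric] c_def
      using sum_insert_weights[OF fin, where v = "v k" and l = l' and b = "s * lump k i" and f = "\<lambda>_. 1 :: real"] by simp
    moreover have "(\<Sum>a\<in>insert (v k) (A k). c a *\<^sub>R K a) \<in> Q"
      by (rule Q_sum) (use fin l' s lump_nonneg v_Ext activeD(2)[OF active, of k] mass_le[of k] calculation(2) in \<open>auto simp: c_def\<close>)
    ultimately show ?thesis by simp
  qed
  have v_dist: "(norm (K (v k) - K (ub i)))\<^sup>2 \<le> Cgap * gap k"
    using dist[of "v k"] i v_Ext not_stopped[of k] by (simp add: less_imp_le)
  \<comment> \<open>Both points are close to the same \<open>ub i\<close>. The factor 2 becomes 4 in
    the square; keeping half of the gain doubles it to the 8 in the condition on
    \<open>s\<close>.\<close>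
  have "norm (K (v k) - K a) \<le> 2 * sqrt (Cgap * gap k)" if "a \<in> A'" for a
  proof -
    have "(norm (K a - K (ub i)))\<^sup>2 \<le> Cgap * gap k"
      using dist[of a] that activeD(2)[OF active, of k] activeD(5)[OF active, of a k]
      by (auto simp: A'_def)
    then have "norm (K a - K (ub i)) \<le> sqrt (Cgap * gap k)" by (rule real_le_rsqrt)
    moreover have "norm (K (v k) - K (ub i)) \<le> sqrt (Cgap * gap k)" using v_dist by (rule real_le_rsqrt)
    ultimately show ?thesis
      using norm_triangle_ineq4[of "K (v k) - K (ub i)" "K a - K (ub i)"] by simp
  qed
  then have "norm (\<Sum>a\<in>A'. l k a *\<^sub>R (K (v k) - K a)) \<le> (\<Sum>a\<in>A'. l k a * (2 * sqrt (Cgap * gap k)))"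
    using l_nonneg A' by (intro sum_norm_le) (auto simp: abs_of_nonneg subset_iff intro!: mult_left_mono)
  also have "\<dots> = lump k i * (2 * sqrt (Cgap * gap k))" by (simp add: lump sum_distrib_right)
  finally have "norm h \<le> s * (lump k i * (2 * sqrt (Cgap * gap k)))"
    using s(1) by (simp add: h_def mult_left_mono)
  then have "(norm h)\<^sup>2 \<le> (s * (lump k i * (2 * sqrt (Cgap * gap k))))\<^sup>2"
    by (rule power_mono) simp
  also have "\<dots> = 4 * s\<^sup>2 * (lump k i)\<^sup>2 * Cgap * gap k"
    using Cgap_nonneg gap_pos[of k] by (simp add: power_mult_distrib)
  finally have "Lip * (norm h)\<^sup>2 \<le> Lip * (4 * s\<^sup>2 * (lump k i)\<^sup>2 * Cgap * gap k)"
    using Lip_nonneg by (rule mult_left_mono)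
  also have "\<dots> = (4 * Lip * Cgap * s * lump k i) * (s * lump k i * gap k)"
    by (simp add: power2_eq_square algebra_simps)
  also have "\<dots> \<le> (1 / 2) * (s * lump k i * gap k)"
  proof (rule mult_right_mono)
    have "4 * Lip * Cgap * s * lump k i \<le> 4 * Lip * Cgap * s * Mbd"
      using lump_le Lip_nonneg Cgap_nonneg s(1) by (intro mult_left_mono) auto
    then show "4 * Lip * Cgap * s * lump k i \<le> 1 / 2" using s(3) by (simp add: algebra_simps)
    show "0 \<le> s * lump k i * gap k" using s lump_nonneg gap_pos[of k] by simp
  qed
  finally have h2: "Lip * (norm h)\<^sup>2 \<le> s * lump k i * gap k / 2" by simp
  \<comment> \<open>Active points have pairing 1 and \<open>v k\<close> has
    \<open>1 + gap k\<close>, so each unit of moved mass gains \<open>gap k\<close>.\<close>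
  have "inner (l k a *\<^sub>R (K (v k) - K a)) (gradient F (K (u k))) = - (l k a * gap k)" if "a \<in> A'" for a
    using activeD(5)[OF active, of a k] that A' by (auto simp: gap_def dual_var inner_simps algebra_simps)
  then have grad: "inner h (gradient F (K (u k))) = - (s * lump k i * gap k)"
    by (simp add: h_def inner_sum_left sum_negf lump sum_distrib_right)
  have "val (u (Suc k)) \<le> F (K (u k) + h) + mass k"
    using step_value[where k = k and l' = l' and b = "s * lump k i", OF l'] s lump_nonneg
    unfolding K_eq mass_eq by simp
  also have "\<dots> \<le> val (u k) - s * lump k i * gap k / 2"
    using F_descent[OF K_u_Q h_Q] h2 grad by (simp add: val_mass)
  finally show ?thesis by (simp add: res_def)
qed

lemma linear_rate:
  obtains c \<zeta> where "0 < c" "3 / 4 \<le> \<zeta>" "\<zeta> < 1" "\<forall>\<^sub>F k in sequentially. res k \<le> c * \<zeta> ^ k"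
proof -
  obtain \<delta> where \<delta>: "0 < \<delta>" "\<forall>\<^sub>F k in sequentially. \<forall>i\<in>{1..N}. \<delta> \<le> lump k i"
    using lump_lower_bound by blast
  define H where "H = 8 * Lip * Cgap * Mbd"
  have H: "0 \<le> H" using Lip_nonneg Cgap_nonneg Mbd_pos by (simp add: H_def)
  define s where "s = 1 / (H + 1)"
  have s: "0 < s" "s \<le> 1" "8 * Lip * Cgap * Mbd * s \<le> 1"
    using H by (auto simp: s_def H_def[symmetric])
  \<comment> \<open>The gain \<open>s * \<delta> * gap k / 2\<close> is at least the fraction
    \<open>s * \<delta> / (2 * Mbd)\<close> of \<open>res k\<close>; the maximum puts the factor
    into the required range.\<close>
  define \<zeta> where "\<zeta> = max (3/4) (1 - s * \<delta> / (2 * Mbd))"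
  have \<zeta>: "3/4 \<le> \<zeta>" "\<zeta> < 1" using s \<delta> Mbd_pos by (auto simp: \<zeta>_def)
  have "\<forall>\<^sub>F k in sequentially. res (Suc k) \<le> \<zeta> * res k"
    using \<delta>(2) localization local_distance_gap
  proof eventually_elim
    case (elim k)
    obtain i where i: "i \<in> {1..N}" "v k \<in> Ub i"
      using elim(2) v_Ext not_stopped[of k] less_imp_le by blast
    have "res (Suc k) \<le> res k - s * lump k i * gap k / 2"
      using res_local_step[OF i less_imp_le[OF s(1)] s(2,3)] elim(3) i(1) by blast
    also have "s * \<delta> * (res k / Mbd) \<le> s * lump k i * gap k"
    proof (rule mult_mono)
      show "s * \<delta> \<le> s * lump k i" using elim(1) i(1) s by simp
      show "res k / Mbd \<le> gap k" using res_le_gap[of k] Mbd_pos by (simp add: field_simps)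
    qed (use s lump_nonneg res_nonneg Mbd_pos in auto)
    then have "res k - s * lump k i * gap k / 2 \<le> (1 - s * \<delta> / (2 * Mbd)) * res k"
      using Mbd_pos by (simp add: field_simps)
    also have "\<dots> \<le> \<zeta> * res k"
      using res_nonneg by (intro mult_right_mono) (auto simp: \<zeta>_def)
    finally show ?case .
  qed
  then obtain n where n: "\<And>k. k \<ge> n \<Longrightarrow> res (Suc k) \<le> \<zeta> * res k"
    unfolding eventually_sequentially by blast
  have rate: "res (n + m) \<le> \<zeta> ^ m * res n" for m
  proof (induction m)
    case (Suc m)
    have "res (n + Suc m) \<le> \<zeta> * res (n + m)" using n[of "n + m"] by simp
    also have "\<dots> \<le> \<zeta> * (\<zeta> ^ m * res n)" using Suc \<zeta> by (intro mult_left_mono) auto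
    finally show ?case by simp
  qed simp
  \<comment> \<open>The added 1 keeps \<open>c\<close> positive if \<open>res n = 0\<close>.\<close>
  define c where "c = (res n + 1) / \<zeta> ^ n"
  have "res k \<le> c * \<zeta> ^ k" if "k \<ge> n" for k
  proof -
    have "res k \<le> \<zeta> ^ (k - n) * res n" using rate[of "k - n"] that by simp
    also have "\<dots> \<le> \<zeta> ^ (k - n) * (res n + 1)" using \<zeta> by (intro mult_left_mono) auto
    also have "\<dots> = c * \<zeta> ^ k" using \<zeta> that by (simp add: c_def power_diff)
    finally show ?thesis .
  qed
  then have "\<forall>\<^sub>F k in sequentially. res k \<le> c * \<zeta> ^ k" using eventually_sequentially by blast
  moreover have "0 < c" using \<zeta> res_nonneg[of n] by (simp add: c_def)
  ultimately show thesis using that \<zeta> by blast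
qed

end

section \<open>Translation of the hypotheses, and the index shift of the run\<close>

theorem theorem3p8:
  fixes F :: "'y::{real_inner, complete_space} \<Rightarrow> real"
    and K :: "('c::banach \<Rightarrow>\<^sub>L real) \<Rightarrow> 'y"
    and G :: "('c \<Rightarrow>\<^sub>L real) \<Rightarrow> ennreal"
    and ubar :: "'c \<Rightarrow>\<^sub>L real" and ybar :: 'y and pbar :: 'c
    and dB :: "('c \<Rightarrow>\<^sub>L real) \<Rightarrow> ('c \<Rightarrow>\<^sub>L real) \<Rightarrow> real"
    and Ny :: "'y set" and \<theta> :: real
    and N :: nat and ub :: "nat \<Rightarrow> ('c \<Rightarrow>\<^sub>L real)"
    and g :: "('c \<Rightarrow>\<^sub>L real) \<Rightarrow> ('c \<Rightarrow>\<^sub>L real) \<Rightarrow> real" and \<tau> \<kappa> :: real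
    and Ub :: "nat \<Rightarrow> ('c \<Rightarrow>\<^sub>L real) set"
    and A :: "nat \<Rightarrow> ('c \<Rightarrow>\<^sub>L real) set" and u :: "nat \<Rightarrow> ('c \<Rightarrow>\<^sub>L real)" and T :: enat
  assumes separable: "separable_space (euclidean :: 'c topology)"
    and F_convex: "convex_on UNIV F"
    and K_linear: "linear K"
    and K_cont: "continuous_map weak_star weak_topology K"
    and G_convex: "convex_ennreal G"
    and G_lsc: "lower_semicontinuous_map weak_star G"
    and G_hom: "pos_homogeneous G"
    and ubar: "ubar = (ARG_MIN (J F K G) w. True)"
    and ybar: "ybar = K ubar"
    and pbar: "pbar = - preadjoint K (gradient F ybar)"
    and dB_metric: "Metric_space (Ext_closure G) dB"
    and dB_topology: "Metric_space.mtopology (Ext_closure G) dB = subtopology weak_star (Ext_closure G)"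
    and i_bdd: "bdd_below (range F)"
    and i_strict: "strictly_convex F"
    and i_diff: "\<And>y. F differentiable (at y)"
    and i_lipschitz: "\<And>S. compact S \<Longrightarrow> \<exists>L. L-lipschitz_on S (gradient F)"
    and ii: "\<And>\<alpha>::real. 0 \<le> \<alpha> \<Longrightarrow> compactin weak_star {w. G w \<le> ennreal \<alpha>}"
    and iii: "\<And>w w\<^sub>0. (\<And>k::nat. G (w k) < \<infinity>) \<Longrightarrow> limitin weak_star w w\<^sub>0 sequentially
                \<Longrightarrow> (\<lambda>k. K (w k)) \<longlonglongrightarrow> K w\<^sub>0"
    and iv: "ybar \<in> interior Ny" "0 < \<theta>"
      "\<And>y1 y2. y1 \<in> Ny \<Longrightarrow> y2 \<in> Ny \<Longrightarrow>
         inner (gradient F y1 - gradient F y2) (y1 - y2) \<ge> \<theta> * (norm (y1 - y2))\<^sup>2"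
    and v: "N \<ge> 1" "inj_on ub {1..N}" "ub ` {1..N} \<subseteq> Ext G"
      "{w. is_arg_max (\<lambda>w. blinfun_apply w pbar) (\<lambda>w. w \<in> Ext_closure G) w} = ub ` {1..N}"
      "{w \<in> Ext_closure G. blinfun_apply w pbar = 1} = ub ` {1..N}"
    and vi: "inj_on (\<lambda>i. K (ub i)) {1..N}" "independent ((\<lambda>i. K (ub i)) ` {1..N})"
    and vii: "\<And>lam :: nat \<Rightarrow> real. (\<forall>i\<in>{1..N}. 0 \<le> lam i) \<Longrightarrow> ubar = (\<Sum>i=1..N. lam i *\<^sub>R ub i)
                \<Longrightarrow> \<forall>i\<in>{1..N}. 0 < lam i"
    and viii_const: "0 < \<tau>" "0 < \<kappa>"
    and viii_g: "\<And>w w'. w \<in> Ext G \<Longrightarrow> w' \<in> Ext G \<Longrightarrow> 0 \<le> g w w'"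
    and viii_disjoint: "disjoint_family_on Ub {1..N}"
    and viii_closed: "\<And>i. i \<in> {1..N} \<Longrightarrow> closedin (Metric_space.mtopology (Ext_closure G) dB) (Ub i)"
    and viii_nbhd: "\<And>i. i \<in> {1..N} \<Longrightarrow>
      \<exists>W. openin (Metric_space.mtopology (Ext_closure G) dB) W \<and> ub i \<in> W \<and> W \<subseteq> Ub i"
    and viii_growth: "\<And>i w. i \<in> {1..N} \<Longrightarrow> w \<in> Ub i \<inter> Ext G \<Longrightarrow>
      norm (K (w - ub i)) \<le> \<tau> * g w (ub i) \<and> 1 - blinfun_apply w pbar \<ge> \<kappa> * (g w (ub i))\<^sup>2"
    and run: "fcgcg_run F K G A u T"
  shows "(\<forall>w. is_arg_min (J F K G) (\<lambda>_. True) w \<longleftrightarrow> w = ubar) \<and>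
    ((\<exists>n. T = enat n \<and> fcgcg_terminates F K G n (u n) \<and> u n = ubar) \<or>
     (T = \<infinity> \<and>
      (\<exists>c \<zeta>. 0 < c \<and> 3/4 \<le> \<zeta> \<and> \<zeta> < 1 \<and>
        (\<forall>\<^sub>F k in sequentially. J F K G (u k) - (INF w. J F K G w) \<le> ereal (c * \<zeta> ^ k))) \<and>
      limitin weak_star u ubar sequentially))"
proof -
  interpret sparse_problem F K G
    by (rule sparse_problem.intro)
      (fact separable F_convex K_linear K_cont G_convex G_hom i_bdd i_strict i_diff i_lipschitz ii iii)+
  \<comment> \<open>\<open>ARG_MIN\<close> denotes a minimizer because one exists.\<close>
  have "is_arg_min (J F K G) (\<lambda>_. True) ubar"
    unfolding ubar arg_min_def by (rule someI_ex) (use minimizer_exists is_arg_min_J_iff in blast)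
  then have min_ubar: "minimizer ubar" by (simp add: is_arg_min_J_iff)
  have pbar_eq: "pbar = dual_var F K ubar" by (simp add: pbar ybar dual_var_def)
  have "\<exists>W. \<forall>i\<in>{1..N}. openin weak_star (W i) \<and> ub i \<in> W i \<and> W i \<inter> Ext_closure G \<subseteq> Ub i"
  proof (rule bchoice, rule ballI)
    fix i assume "i \<in> {1..N}"
    then show "\<exists>W. openin weak_star W \<and> ub i \<in> W \<and> W \<inter> Ext_closure G \<subseteq> Ub i"
      using viii_nbhd[of i] unfolding dB_topology openin_subtopology by blast
  qed
  then obtain W where W: "\<And>i. i \<in> {1..N} \<Longrightarrow> openin weak_star (W i)" "\<And>i. i \<in> {1..N} \<Longrightarrow> ub i \<in> W i"
    "\<And>i. i \<in> {1..N} \<Longrightarrow> W i \<inter> Ext_closure G \<subseteq> Ub i" by blast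
  have dual_le: "blinfun_apply w (dual_var F K ubar) \<le> 1" if w: "w \<in> Ext_closure G" for w
  proof -
    have "ub 1 \<in> ub ` {1..N}" using v(1) by simp
    then have "blinfun_apply (ub 1) pbar = 1" "\<not> blinfun_apply (ub 1) pbar < blinfun_apply w pbar"
      using v(4,5) w unfolding is_arg_max_def by blast+
    then show ?thesis by (simp add: pbar_eq)
  qed
  have dual_eq: "{w \<in> Ext_closure G. blinfun_apply w (dual_var F K ubar) = 1} = ub ` {1..N}"
    using v(5) unfolding pbar_eq .
  have Ny: "K ubar \<in> interior Ny" using iv(1) unfolding ybar .
  have growth_K: "norm (K (w - ub i)) \<le> \<tau> * g w (ub i)"
    and growth_dual: "\<kappa> * (g w (ub i))\<^sup>2 \<le> 1 - blinfun_apply w (dual_var F K ubar)"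
    if "i \<in> {1..N}" "w \<in> Ub i \<inter> Ext G" for i w
    using viii_growth[OF that] unfolding pbar_eq by blast+
  interpret sparse_source F K G ubar N ub Ny \<theta> g \<tau> \<kappa> Ub W
    by unfold_locales (fact min_ubar Ny iv(2) iv(3) v(1) v(2) v(3) dual_le dual_eq vi(1) vi(2) vii
      viii_const viii_g viii_disjoint W growth_K growth_dual)+
  have unique: "is_arg_min (J F K G) (\<lambda>_. True) w \<longleftrightarrow> w = ubar" for w
    by (simp add: is_arg_min_J_iff minimizer_unique)
  have J_ubar: "J F K G ubar = ereal (obj ubar)"
    using min_ubar by (simp add: minimizer_def J_finite)
  have "J F K G ubar \<le> J F K G w" for w
    using unique[of ubar] by (simp add: is_arg_min_def not_less)
  then have inf: "(INF w. J F K G w) = ereal (obj ubar)"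
    unfolding J_ubar[symmetric] by (intro antisym INF_lower INF_greatest) auto
  show ?thesis
  proof (cases T)
    case (enat n)
    then have "fcgcg_terminates F K G n (u n)" "minimizer (u n)"
      using fcgcg_run_finite[of A u n] run by auto
    then show ?thesis using unique enat minimizer_unique by blast
  next
    case infinity
    obtain l v where lv: "\<And>k. active (A (Suc k)) (u (Suc k)) (l k)"
      "\<And>k. pass (A (Suc k)) (u (Suc k)) (u (Suc (Suc k))) (v k)"
      using fcgcg_run_infinite[of A u] run unfolding infinity by blast
    interpret fcgcg_tail F K G ubar N ub Ny \<theta> g \<tau> \<kappa> Ub W "\<lambda>k. A (Suc k)" "\<lambda>k. u (Suc k)" l v
      by unfold_locales (fact lv)+
    obtain c \<zeta> where c: "0 < c" "3 / 4 \<le> \<zeta>" "\<zeta> < 1" "\<forall>\<^sub>F k in sequentially. res k \<le> c * \<zeta> ^ k"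
      using linear_rate by blast
    \<comment> \<open>The tail starts at iterate 1; dividing \<open>c\<close> by
      \<open>\<zeta>\<close> makes up for the shifted exponent.\<close>
    have "\<forall>\<^sub>F k in sequentially. J F K G (u (Suc k)) - (INF w. J F K G w) \<le> ereal (c / \<zeta> * \<zeta> ^ Suc k)"
      using c(4)
    proof (rule eventually_mono)
      fix k assume "res k \<le> c * \<zeta> ^ k"
      then have "obj (u (Suc k)) - obj ubar \<le> c / \<zeta> * \<zeta> ^ Suc k"
        using active_obj_le_val[OF lv(1), of k] c(2) by (simp add: res_def)
      then show "J F K G (u (Suc k)) - (INF w. J F K G w) \<le> ereal (c / \<zeta> * \<zeta> ^ Suc k)"
        using G_u_finite[of k] by (simp add: inf J_finite)
    qed
    then have "\<forall>\<^sub>F k in sequentially. J F K G (u k) - (INF w. J F K G w) \<le> ereal (c / \<zeta> * \<zeta> ^ k)"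
      by (subst (asm) eventually_sequentially_Suc)
    moreover have "0 < c / \<zeta>" using c by simp
    moreover have "limitin weak_star u ubar sequentially"
      unfolding limitin_weak_star_iff
    proof
      fix x
      have "(\<lambda>n. blinfun_apply (u (Suc n)) x) \<longlonglongrightarrow> blinfun_apply ubar x"
        using u_tendsto unfolding limitin_weak_star_iff by blast
      then show "(\<lambda>n. blinfun_apply (u n) x) \<longlonglongrightarrow> blinfun_apply ubar x"
        by (rule LIMSEQ_imp_Suc)
    qed
    ultimately show ?thesis using unique infinity c(2,3) by blast
  qed
qed

end
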